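(* For $n\ge 1$ and integers $m,e,\ell\ge 0$, let $\delta_{n,m,e,\ell}$ be the number of elements $x\in W(D_n)$ with $x^2=1$, of length $\ell$ in $W(D_n)$, whose expression as a product of disjoint signed cycles contains exactly $m$ transpositions and exactly $e$ negative $1$-cycles, and let $L_{n,m,e}(t)=\sum_{\ell=0}^{\infty}\delta_{n,m,e,\ell}t^{\ell}$. Define polynomials $D_{n,m,e}(t)$ as follows: $D_{n,0,0}(t)=1$; $D_{n,m,e}(t)=0$ if $2m+e>n$; $D_{n,m,e}(t)=0$ if $m<0$ or $e<0$; $D_{1,0,1}(t)=1$, $D_{2,1,0}(t)=2t$, $D_{2,0,1}(t)=1+t^2$, $D_{2,0,2}(t)=t^2$; and for all $n\ge 3$ (and $m,e\ge 0$), $$D_{n,m,e}(t)=D_{n-1,m,e}(t)+t^{2n-2}D_{n-1,m,e-1}(t)+\frac{t(1+t^{2n-4})(t^{2n-2}-1)}{t^2-1}D_{n-2,m-1,e}(t).$$ Then for every non-negative integer $\ell$, $\delta_{n,m,e,\ell}$ is the coefficient of $t^{\ell}$ in $D_{n,m,e}(t)$ when $e$ is even, and is zero when $e$ is odd. Furthermore $L_{n,m,e}(t)=D_{n,m,e}(t)$ when $e$ is even and $L_{n,m,e}(t)=0$ when $e$ is odd.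
   Context: $W(B_n)$ ($n\ge 1$) is the group of signed permutations of $\{1,\dots,n\}$: bijections $w$ of $\{\pm1,\dots,\pm n\}$ with $w(-i)=-w(i)$, acting on $\mathbb{R}^n$ with orthonormal basis $e_1,\dots,e_n$ by $w\cdot e_i=e_{w(i)}$, where $e_{-i}=-e_i$. $W(D_n)$ is the subgroup of those $w$ for which the number of $i\in\{1,\dots,n\}$ with $w(i)<0$ is even (this definition is used for all $n\ge1$, including $n=1,2,3$). The positive roots of $D_n$ are $e_j\pm e_i$ ($1\le i<j\le n$), and for $n\ge 2$ the fundamental reflections are those in the simple roots $e_1+e_2$ and $e_{i+1}-e_i$ ($1\le i<n$). The length of $w\in W(D_n)$ is the least number of fundamental reflections in an expression for $w$; equivalently it is the number of roots $e_j\pm e_i$ ($i<j$) sent by $w$ to negatives of such roots. An element with $w^2=1$ is a product of disjoint signed cycles each of which is a positive $1$-cycle ($i\mapsto i$), a negative $1$-cycle ($i\mapsto -i$), or a transposition, namely $i\leftrightarrow j$ or $i\mapsto -j,\ j\mapsto -i$ with $i\ne j$. The identity counts as an involution, so $\delta_{n,0,0,0}=1$. *)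

theory Defs
  imports "HOL-Combinatorics.Combinatorics" "HOL-Computational_Algebra.Computational_Algebra"
begin

(* Signed permutations are functions on int that fix every integer outside
   {1..n} and {-n..-1}, so each group element is exactly one function and the
   group product is composition. *)
definition WB :: "nat \<Rightarrow> (int \<Rightarrow> int) set" where
  "WB n = {w. w permutes ({- int n..int n} - {0}) \<and>
              (\<forall>i \<in> {- int n..int n} - {0}. w (- i) = - w i)}"

definition WD :: "nat \<Rightarrow> (int \<Rightarrow> int) set" where
  "WD n = {w \<in> WB n. even (card {i \<in> {1..int n}. w i < 0})}"

(* R^n is modelled by the functions vanishing outside {1..n}. *)
definition Rn :: "nat \<Rightarrow> (int \<Rightarrow> real) set" where
  "Rn n = {v. \<forall>k. k \<notin> {1..int n} \<longrightarrow> v k = 0}"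

definition ip :: "nat \<Rightarrow> (int \<Rightarrow> real) \<Rightarrow> (int \<Rightarrow> real) \<Rightarrow> real" where
  "ip n u v = (\<Sum>k = 1..int n. u k * v k)"

(* For i > 0 these are the standard basis vectors, and e_{-i} = - e_i. *)
definition evec :: "int \<Rightarrow> int \<Rightarrow> real" where
  "evec i = (\<lambda>k. if k = \<bar>i\<bar> then of_int (sgn i) else 0)"

(* The linear extension of e_i |-> e_{w(i)}. *)
definition act :: "nat \<Rightarrow> (int \<Rightarrow> int) \<Rightarrow> (int \<Rightarrow> real) \<Rightarrow> (int \<Rightarrow> real)" where
  "act n w v = (\<lambda>k. \<Sum>i = 1..int n. v i * evec (w i) k)"

definition refl_in :: "nat \<Rightarrow> (int \<Rightarrow> real) \<Rightarrow> (int \<Rightarrow> real) \<Rightarrow> (int \<Rightarrow> real)" where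
  "refl_in n a v = (\<lambda>k. v k - 2 * ip n v a / ip n a a * a k)"

definition simple_roots :: "nat \<Rightarrow> (int \<Rightarrow> real) set" where
  "simple_roots n =
     (if n \<ge> 2 then {\<lambda>k. evec 1 k + evec 2 k} else {}) \<union>
     {\<lambda>k. evec (i + 1) k - evec i k | i. 1 \<le> i \<and> i < int n}"

definition fund_refls :: "nat \<Rightarrow> (int \<Rightarrow> int) set" where
  "fund_refls n = {s \<in> WD n. \<exists>a \<in> simple_roots n. \<forall>v \<in> Rn n. act n s v = refl_in n a v}"

abbreviation comp_list :: "(int \<Rightarrow> int) list \<Rightarrow> (int \<Rightarrow> int)" where
  "comp_list ws \<equiv> foldr (\<circ>) ws id"

definition lenD :: "nat \<Rightarrow> (int \<Rightarrow> int) \<Rightarrow> nat" where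
  "lenD n w = (LEAST k. \<exists>ss. length ss = k \<and> set ss \<subseteq> fund_refls n \<and> comp_list ss = w)"

definition neg_cycle :: "int \<Rightarrow> int \<Rightarrow> int" where
  "neg_cycle i = (\<lambda>k. if \<bar>k\<bar> = \<bar>i\<bar> then - k else k)"

(* For j of either sign: i |-> j, j |-> i, -i |-> -j, -j |-> -i.  With i, j > 0 the
   two kinds of transposition are signed_transp i j and signed_transp i (-j). *)
definition signed_transp :: "int \<Rightarrow> int \<Rightarrow> int \<Rightarrow> int" where
  "signed_transp i j = (\<lambda>k. if k = i then j else if k = j then i
                            else if k = - i then - j else if k = - j then - i else k)"

definition neg_cycles :: "nat \<Rightarrow> (int \<Rightarrow> int) set" where
  "neg_cycles n = {neg_cycle i | i. i \<in> {1..int n}}"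

definition transps :: "nat \<Rightarrow> (int \<Rightarrow> int) set" where
  "transps n =
     {signed_transp i j | i j. i \<in> {1..int n} \<and> j \<in> {1..int n} \<and> i \<noteq> j} \<union>
     {signed_transp i (- j) | i j. i \<in> {1..int n} \<and> j \<in> {1..int n} \<and> i \<noteq> j}"

definition supp :: "(int \<Rightarrow> int) \<Rightarrow> int set" where
  "supp c = {k. c k \<noteq> k}"

(* x is a product of disjoint signed cycles, namely m transpositions, e negative
   1-cycles and otherwise positive 1-cycles.  The latter are identity maps and are
   omitted from the product. *)
definition has_cycle_expr :: "nat \<Rightarrow> nat \<Rightarrow> nat \<Rightarrow> (int \<Rightarrow> int) \<Rightarrow> bool" where
  "has_cycle_expr n m e x \<longleftrightarrow>
     (\<exists>ts ns. length ts = m \<and> set ts \<subseteq> transps n \<and>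
              length ns = e \<and> set ns \<subseteq> neg_cycles n \<and>
              sorted_wrt (\<lambda>c d. supp c \<inter> supp d = {}) (ts @ ns) \<and>
              x = comp_list (ts @ ns))"

definition delta :: "nat \<Rightarrow> nat \<Rightarrow> nat \<Rightarrow> nat \<Rightarrow> nat" where
  "delta n m e l =
     card {x \<in> WD n. x \<circ> x = id \<and> lenD n x = l \<and> has_cycle_expr n m e x}"

definition L :: "nat \<Rightarrow> nat \<Rightarrow> nat \<Rightarrow> int fps" where
  "L n m e = Abs_fps (\<lambda>l. int (delta n m e l))"

abbreviation tX :: "int poly" where
  "tX \<equiv> [:0, 1:]"

(* div on int poly is exact here, see Dcoef_exact. *)
definition Dcoef :: "nat \<Rightarrow> int poly" where
  "Dcoef n = (tX * (1 + tX ^ (2 * n - 4)) * (tX ^ (2 * n - 2) - 1)) div (tX ^ 2 - 1)"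

(* The prescribed values overlap with the recursion; Dpoly_rec below shows that the
   recursion nevertheless holds for all m and e.  Only n \<ge> 1 is meaningful. *)
function Dpoly :: "nat \<Rightarrow> int \<Rightarrow> int \<Rightarrow> int poly" where
  "Dpoly n m e =
     (if m < 0 \<or> e < 0 \<or> 2 * m + e > int n then 0
      else if m = 0 \<and> e = 0 then 1
      else if n = 1 \<and> m = 0 \<and> e = 1 then 1
      else if n = 2 \<and> m = 1 \<and> e = 0 then 2 * tX
      else if n = 2 \<and> m = 0 \<and> e = 1 then 1 + tX ^ 2
      else if n = 2 \<and> m = 0 \<and> e = 2 then tX ^ 2
      else if n \<ge> 3 then
        Dpoly (n - 1) m e + tX ^ (2 * n - 2) * Dpoly (n - 1) m (e - 1)
          + Dcoef n * Dpoly (n - 2) (m - 1) e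
      else 0)"
  by auto
termination by (relation "measure (\<lambda>(n, m, e). n)") auto

declare Dpoly.simps [simp del]

lemma Dcoef_exact:
  assumes "n \<ge> 1"
  shows "Dcoef n * (tX ^ 2 - 1) = tX * (1 + tX ^ (2 * n - 4)) * (tX ^ (2 * n - 2) - 1)"
proof -
  have *: "a * b div d * d = a * b" if "d dvd b" for a b d :: "int poly"
    by (rule dvd_div_mult_self) (rule dvd_mult [OF that])
  have "x ^ 2 - 1 dvd x ^ (2 * n - 2) - 1" for x :: "int poly"
  proof -
    have "2 * n - 2 = 2 * (n - 1)" by simp
    then have "x ^ (2 * n - 2) = (x ^ 2) ^ (n - 1)"
      by (simp only: power_mult)
    then show ?thesis
      by (simp only: power_diff_1_eq dvd_triv_left)
  qed
  then show ?thesis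
    unfolding Dcoef_def by (rule *)
qed

lemma Dpoly_0_0: "Dpoly n 0 0 = 1"
  by (subst Dpoly.simps) simp

lemma Dpoly_eq_0: "2 * m + e > int n \<or> m < 0 \<or> e < 0 \<Longrightarrow> Dpoly n m e = 0"
  by (subst Dpoly.simps) auto

lemma Dpoly_initial:
  "Dpoly 1 0 1 = 1" "Dpoly 2 1 0 = 2 * tX" "Dpoly 2 0 1 = 1 + tX ^ 2" "Dpoly 2 0 2 = tX ^ 2"
  by (subst Dpoly.simps, simp)+

lemma Dpoly_rec:
  assumes "n \<ge> 3" "m \<ge> 0" "e \<ge> 0"
  shows "Dpoly n m e = Dpoly (n - 1) m e + tX ^ (2 * n - 2) * Dpoly (n - 1) m (e - 1)
           + Dcoef n * Dpoly (n - 2) (m - 1) e"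
proof (cases "2 * m + e > int n \<or> m = 0 \<and> e = 0")
  case True
  then show ?thesis
    using assms by (auto simp: Dpoly_0_0 Dpoly_eq_0)
next
  case False
  then show ?thesis
    using assms by (subst Dpoly.simps) auto
qed

end

(* The length of w in W(D_n) is its number of inversions with respect to the roots e_j +- e_i:
   left multiplication by a simple reflection changes this number by exactly one, and an element
   of W(D_n) without descents is the identity.

   Signed involutions are then counted by inversions, on an arbitrary finite set S of positive
   integers instead of {1..n}, so that points can be removed without relabelling the others.
   Let k be the maximum of S and p = card S - 1.  If k is a positive 1-cycle, removing it leaves
   the number of inversions unchanged; if k is a negative 1-cycle, it removes 2p of them.  If k
   is exchanged with j or -j, where j has a elements of S - {k} above and b below it, it removes
   1 + 2a or 1 + 2a + 4b = 1 + 2(p - 1) + 2b inversions respectively, irrespective of the rest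
   of the involution.  Summing over j gives
     t (1 + t^(2p-2)) (1 + t^2 + ... + t^(2p-2)),
   which is the coefficient of the last term of the recursion for n = p + 1.  The parity
   condition defining W(D_n) only says that e is even, so it plays no part in the count. *)

theory Submission
  imports Defs
begin

section \<open>Signed permutations and involutions\<close>

text \<open>Every element is a function on all of \<open>int\<close>, whatever \<open>S\<close> is,
  so the elements for a subset also belong to the larger set and involutions on disjoint sets can be
  composed directly. Oddness is required everywhere; where \<open>\<bar>i\<bar>\<close> lies outside
  \<open>S\<close> it follows from \<open>w i = i\<close>.\<close>

definition signed_perms :: "int set \<Rightarrow> (int \<Rightarrow> int) set" where
  "signed_perms S = {w. bij w \<and> (\<forall>i. w (- i) = - w i) \<and> (\<forall>i. \<bar>i\<bar> \<notin> S \<longrightarrow> w i = i)}"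

definition signed_invols :: "int set \<Rightarrow> (int \<Rightarrow> int) set" where
  "signed_invols S = {x \<in> signed_perms S. x \<circ> x = id}"

lemma signed_permsD:
  assumes "w \<in> signed_perms S"
  shows "bij w" "inj w" "w (- i) = - w i" "\<bar>i\<bar> \<notin> S \<Longrightarrow> w i = i"
  using assms by (auto simp: signed_perms_def bij_is_inj)

lemma signed_perms_abs_eq_iff:
  assumes "w \<in> signed_perms S"
  shows "\<bar>w i\<bar> = \<bar>w j\<bar> \<longleftrightarrow> \<bar>i\<bar> = \<bar>j\<bar>"
  using signed_permsD(3)[OF assms] injD[OF signed_permsD(2)[OF assms]]
  by (metis abs_eq_iff)

text \<open>If \<open>\<bar>w i\<bar>\<close> were outside \<open>S\<close>, then
  \<open>w (w i) = w i\<close>, and injectivity would make \<open>i\<close> itself a fixed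
  point.\<close>

lemma signed_perms_abs_mem:
  assumes "w \<in> signed_perms S" "\<bar>i\<bar> \<in> S"
  shows "\<bar>w i\<bar> \<in> S"
  using assms signed_permsD(2,4)[OF assms(1)] by (metis injD)

text \<open>Forgetting the signs turns \<open>w\<close> into a permutation of \<open>S\<close>,
  along which sums and products over \<open>S\<close> are reindexed later.\<close>

lemma signed_perms_bij_betw_abs:
  assumes "w \<in> signed_perms S" "finite S" "S \<subseteq> {0<..}"
  shows "bij_betw (\<lambda>i. \<bar>w i\<bar>) S S"
proof -
  have "inj_on (\<lambda>i. \<bar>w i\<bar>) S"
  proof (rule inj_onI)
    fix i j assume "i \<in> S" "j \<in> S" "\<bar>w i\<bar> = \<bar>w j\<bar>"
    then have "\<bar>i\<bar> = \<bar>j\<bar>" "0 < i" "0 < j"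
      using signed_perms_abs_eq_iff[OF assms(1)] assms(3) by auto
    then show "i = j" by simp
  qed
  moreover have "(\<lambda>i. \<bar>w i\<bar>) ` S \<subseteq> S"
    using signed_perms_abs_mem[OF assms(1)] assms(3) by fastforce
  ultimately show ?thesis
    using endo_inj_surj[OF assms(2)] by (auto simp: bij_betw_def)
qed

lemma id_signed_perms: "id \<in> signed_perms S"
  by (auto simp: signed_perms_def)

lemma comp_signed_perms:
  "v \<in> signed_perms S \<Longrightarrow> w \<in> signed_perms S \<Longrightarrow> v \<circ> w \<in> signed_perms S"
  by (auto simp: signed_perms_def bij_comp)

lemma signed_perms_mono: "S \<subseteq> T \<Longrightarrow> signed_perms S \<subseteq> signed_perms T"
  by (auto simp: signed_perms_def)

lemma inv_signed_perms:
  assumes "w \<in> signed_perms S"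
  shows "inv w \<in> signed_perms S"
proof -
  note w = signed_permsD[OF assms]
  have "inv w (- i) = - inv w i" for i
    using w by (metis bij_inv_eq_iff)
  moreover have "\<bar>i\<bar> \<notin> S \<Longrightarrow> inv w i = i" for i
    using w by (metis inv_f_f)
  ultimately show ?thesis
    using w(1) by (simp add: signed_perms_def bij_imp_bij_inv)
qed

lemma signed_perms_eqI:
  assumes "v \<in> signed_perms S" "w \<in> signed_perms S" "\<And>i. i \<in> S \<Longrightarrow> v i = w i"
  shows "v = w"
proof
  fix i
  show "v i = w i"
    using assms(3)[of i] assms(3)[of "- i"] signed_permsD(3,4)[OF assms(1), of i]
      signed_permsD(3,4)[OF assms(2), of i]
    by (cases "\<bar>i\<bar> \<in> S") (auto simp: abs_if split: if_splits)
qed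

lemma WB_eq: "WB n = signed_perms {1..int n}"
proof -
  have fix_iff: "i \<notin> {- int n..int n} - {0} \<longleftrightarrow> \<bar>i\<bar> \<notin> {1..int n}" for i
    by auto
  have "w permutes ({- int n..int n} - {0}) \<longleftrightarrow>
      bij w \<and> (\<forall>i. \<bar>i\<bar> \<notin> {1..int n} \<longrightarrow> w i = i)" for w :: "int \<Rightarrow> int"
    unfolding permutes_def bij_iff using fix_iff by blast
  moreover have "(\<forall>i \<in> {- int n..int n} - {0}. w (- i) = - w i) \<longleftrightarrow> (\<forall>i. w (- i) = - w i)"
    if "\<forall>i. \<bar>i\<bar> \<notin> {1..int n} \<longrightarrow> w i = i" for w :: "int \<Rightarrow> int"
    using that fix_iff by (metis abs_minus_cancel)
  ultimately show ?thesis
    unfolding WB_def signed_perms_def by blast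
qed

lemma signed_involsI:
  assumes "\<And>i. x (x i) = i" "\<And>i. x (- i) = - x i" "\<And>i. \<bar>i\<bar> \<notin> S \<Longrightarrow> x i = i"
  shows "x \<in> signed_invols S"
proof -
  have "x \<circ> x = id"
    using assms(1) by auto
  then show ?thesis
    using assms by (auto simp: signed_invols_def signed_perms_def o_bij)
qed

lemma signed_involsD:
  assumes "x \<in> signed_invols S"
  shows "x \<in> signed_perms S" "x (x i) = i" "x (- i) = - x i" "\<bar>i\<bar> \<notin> S \<Longrightarrow> x i = i"
    "\<bar>i\<bar> \<in> S \<Longrightarrow> \<bar>x i\<bar> \<in> S"
  using assms signed_permsD[of x S] signed_perms_abs_mem[of x S i]
  by (auto simp: signed_invols_def fun_eq_iff)

lemma signed_invols_mono: "S \<subseteq> T \<Longrightarrow> signed_invols S \<subseteq> signed_invols T"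
  using signed_perms_mono by (auto simp: signed_invols_def)

lemma finite_signed_invols:
  assumes "finite S"
  shows "finite (signed_invols S)"
proof (rule finite_subset)
  show "signed_invols S \<subseteq> {w. w permutes (S \<union> uminus ` S)}"
  proof (clarify)
    fix x assume "x \<in> signed_invols S"
    note x = signed_involsD[OF this]
    have "x i = i" if "i \<notin> S \<union> uminus ` S" for i
    proof -
      have "i \<notin> S" "- i \<notin> S"
        using that by (auto intro: image_eqI[of i uminus "- i"])
      then show ?thesis
        using x(4)[of i] by (simp add: abs_if split: if_splits)
    qed
    moreover have "bij x"
      using x(1) by (simp add: signed_perms_def)
    ultimately show "x permutes (S \<union> uminus ` S)"
      by (auto simp: permutes_def bij_iff)
  qed
  show "finite {w. w permutes (S \<union> uminus ` S)}"
    using assms by (simp add: finite_permutations)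
qed

section \<open>Composing involutions on disjoint sets of absolute values\<close>

lemma neg_cycle_signed_invols: "0 < i \<Longrightarrow> neg_cycle i \<in> signed_invols {i}"
  by (rule signed_involsI) (auto simp: neg_cycle_def)

lemma signed_transp_signed_invols:
  assumes "p \<noteq> 0" "q \<noteq> 0" "\<bar>p\<bar> \<noteq> \<bar>q\<bar>"
  shows "signed_transp p q \<in> signed_invols {\<bar>p\<bar>, \<bar>q\<bar>}"
  using assms by (intro signed_involsI) (auto simp: signed_transp_def abs_if split: if_splits)

text \<open>Each factor preserves the points over its own set and fixes those over the other, so the
  two do not interact.\<close>

lemma signed_invols_glue:
  assumes c: "c \<in> signed_invols T" and T: "T \<subseteq> S" "T \<subseteq> {0<..}" and y: "y \<in> signed_invols (S - T)"
  shows "c \<circ> y = (\<lambda>i. if \<bar>i\<bar> \<in> T then c i else y i)" "c \<circ> y \<in> signed_invols S"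
proof -
  note c = signed_involsD[OF c] and y = signed_involsD[OF y]
  show eq: "c \<circ> y = (\<lambda>i. if \<bar>i\<bar> \<in> T then c i else y i)"
  proof
    fix i
    show "(c \<circ> y) i = (if \<bar>i\<bar> \<in> T then c i else y i)"
    proof (cases "\<bar>i\<bar> \<in> S - T")
      case True
      then show ?thesis using y(5)[OF True] c(4)[of "y i"] by simp
    next
      case False
      then show ?thesis using y(4)[OF False] c(4)[of i] by auto
    qed
  qed
  show "c \<circ> y \<in> signed_invols S"
  proof (rule signed_involsI)
    fix i
    show "(c \<circ> y) ((c \<circ> y) i) = i"
    proof (cases "\<bar>i\<bar> \<in> T")
      case True
      then show ?thesis using c(2)[of i] c(5)[OF True] by (simp add: eq)
    next
      case False
      then have "\<bar>y i\<bar> \<notin> T"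
        using y(4,5)[of i] by (cases "\<bar>i\<bar> \<in> S") auto
      then show ?thesis using False y(2) by (simp add: eq)
    qed
  next
    fix i show "(c \<circ> y) (- i) = - (c \<circ> y) i"
      using c(3) y(3) by simp
  next
    fix i assume "\<bar>i\<bar> \<notin> S"
    then show "(c \<circ> y) i = i"
      using T c(4)[of i] y(4)[of i] by auto
  qed
qed

text \<open>By oddness \<open>x\<close> agrees with \<open>c\<close> at all points over
  \<open>T\<close>. Hence \<open>x\<close> preserves these points and also the remaining ones;
  composing with \<open>c\<close> undoes \<open>x\<close> on the former and leaves it unchanged on
  the latter.\<close>

lemma signed_invols_unglue:
  assumes c: "c \<in> signed_invols T" and T: "T \<subseteq> S" "T \<subseteq> {0<..}" and x: "x \<in> signed_invols S"
    and agree: "\<And>i. i \<in> T \<Longrightarrow> x i = c i"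
  shows "c \<circ> x \<in> signed_invols (S - T)"
proof -
  note c = signed_involsD[OF c] and x = signed_involsD[OF x]
  have agree': "x i = c i" if "\<bar>i\<bar> \<in> T" for i
    using that agree[of i] agree[of "- i"] x(3)[of i] c(3)[of i]
    by (auto simp: abs_if split: if_splits)
  have stable: "\<bar>x i\<bar> \<notin> T" if "\<bar>i\<bar> \<notin> T" for i
    using that agree'[of "x i"] x(2)[of i] c(5)[of "x i"] by auto
  have eq: "c \<circ> x = (\<lambda>i. if \<bar>i\<bar> \<in> T then i else x i)"
    using agree' stable c(2,4) by (auto simp: fun_eq_iff)
  show ?thesis
  proof (rule signed_involsI)
    fix i show "(c \<circ> x) ((c \<circ> x) i) = i"
      using stable[of i] x(2)[of i] by (simp add: eq)
  next
    fix i show "(c \<circ> x) (- i) = - (c \<circ> x) i"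
      using c(3) x(3) by simp
  next
    fix i assume "\<bar>i\<bar> \<notin> S - T"
    then show "(c \<circ> x) i = i"
      using x(4)[of i] by (auto simp: eq)
  qed
qed

text \<open>Composition with the involution \<open>c\<close> is its own inverse, so gluing and
  ungluing are the two directions.\<close>

lemma bij_betw_glue:
  assumes c: "c \<in> signed_invols T" and T: "T \<subseteq> S" "T \<subseteq> {0<..}"
  shows "bij_betw ((\<circ>) c) (signed_invols (S - T)) {x \<in> signed_invols S. \<forall>i \<in> T. x i = c i}"
proof (rule bij_betwI)
  have cc: "c \<circ> (c \<circ> y) = y" for y :: "int \<Rightarrow> int"
    using signed_involsD(2)[OF c] by auto
  show "(\<circ>) c \<in> signed_invols (S - T) \<rightarrow> {x \<in> signed_invols S. \<forall>i \<in> T. x i = c i}"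
  proof
    fix y assume y: "y \<in> signed_invols (S - T)"
    have "(c \<circ> y) i = c i" if "i \<in> T" for i
      using that T by (auto simp: signed_invols_glue(1)[OF assms y])
    then show "c \<circ> y \<in> {x \<in> signed_invols S. \<forall>i \<in> T. x i = c i}"
      using signed_invols_glue(2)[OF assms y] by simp
  qed
  show "(\<circ>) c \<in> {x \<in> signed_invols S. \<forall>i \<in> T. x i = c i} \<rightarrow> signed_invols (S - T)"
    using signed_invols_unglue[OF assms] by blast
  show "c \<circ> (c \<circ> y) = y" "c \<circ> (c \<circ> y) = y" for y :: "int \<Rightarrow> int"
    by (rule cc)+
qed

section \<open>Negative 1-cycles and moved points\<close>

definition negs :: "(int \<Rightarrow> int) \<Rightarrow> nat" where
  "negs x = card {i. 0 < i \<and> x i = - i}"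

text \<open>Each transposition moves two absolute values, so for an involution this is twice the
  number of transpositions. Like \<open>negs\<close>, it is read off the function alone, without a
  chosen product of cycles.\<close>

definition movs :: "(int \<Rightarrow> int) \<Rightarrow> nat" where
  "movs x = card {i. 0 < i \<and> \<bar>x i\<bar> \<noteq> i}"

lemma supp_signed_perms: "w \<in> signed_perms S \<Longrightarrow> supp w \<subseteq> {i. \<bar>i\<bar> \<in> S}"
  by (auto simp: supp_def signed_perms_def)

lemma finite_abs_vimage: "finite S \<Longrightarrow> finite {i :: int. \<bar>i\<bar> \<in> S}"
proof -
  assume "finite S"
  moreover have "{i :: int. \<bar>i\<bar> \<in> S} \<subseteq> S \<union> uminus ` S"
    by (auto simp: abs_if image_iff split: if_splits) (metis minus_minus)
  ultimately show ?thesis by (meson finite_UnI finite_imageI finite_subset)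
qed

lemma finite_supp: "finite S \<Longrightarrow> w \<in> signed_perms S \<Longrightarrow> finite (supp w)"
  using supp_signed_perms finite_abs_vimage finite_subset by metis

text \<open>By injectivity, \<open>y\<close> sends a point that it moves to another point that it
  moves, and \<open>c\<close> fixes that one.\<close>

lemma comp_disjoint_supp:
  assumes "inj y" "supp c \<inter> supp y = {}"
  shows "(c \<circ> y) k = (if k \<in> supp c then c k else y k)"
proof (cases "y k = k")
  case False
  then have "y (y k) \<noteq> y k"
    using assms(1) by (metis injD)
  then show ?thesis
    using False assms(2) by (auto simp: supp_def)
next
  case True
  then show ?thesis by (auto simp: supp_def)
qed

lemma supp_comp:
  assumes "inj y" "supp c \<inter> supp y = {}"
  shows "supp (c \<circ> y) = supp c \<union> supp y"
proof -
  have "(c \<circ> y) k \<noteq> k \<longleftrightarrow> c k \<noteq> k \<or> y k \<noteq> k" for k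
    using assms(2) unfolding comp_disjoint_supp[OF assms] by (auto simp: supp_def)
  then show ?thesis unfolding supp_def by auto
qed

lemma
  assumes "inj y" "supp c \<inter> supp y = {}" "finite (supp c)" "finite (supp y)"
  shows negs_comp: "negs (c \<circ> y) = negs c + negs y"
    and movs_comp: "movs (c \<circ> y) = movs c + movs y"
proof -
  \<comment> \<open>Both counts are treated at once. \<open>P f i\<close> depends on
    \<open>f\<close> only through \<open>f i\<close> and forces \<open>f\<close> to move
    \<open>i\<close>, so the counted points split along the two disjoint supports.\<close>
  have split: "card {i. 0 < i \<and> P (c \<circ> y) i} = card {i. 0 < i \<and> P c i} + card {i. 0 < i \<and> P y i}"
    if P: "\<And>f i. 0 < i \<Longrightarrow> P f i \<Longrightarrow> f i \<noteq> i" "\<And>f g i. f i = g i \<Longrightarrow> P f i = P g i"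
    for P :: "(int \<Rightarrow> int) \<Rightarrow> int \<Rightarrow> bool"
  proof -
    have sub: "{i. 0 < i \<and> P f i} \<subseteq> supp f" for f
      using P(1) by (auto simp: supp_def)
    have "P (c \<circ> y) i \<longleftrightarrow> P c i \<or> P y i" if "0 < i" for i
    proof (cases "i \<in> supp c")
      case True
      then have "P (c \<circ> y) i = P c i"
        using comp_disjoint_supp[OF assms(1,2), of i] by (intro P(2)) simp
      moreover have "\<not> P y i"
        using True assms(2) sub[of y] that by auto
      ultimately show ?thesis by simp
    next
      case False
      then have "P (c \<circ> y) i = P y i"
        using comp_disjoint_supp[OF assms(1,2), of i] by (intro P(2)) simp
      moreover have "\<not> P c i"
        using False sub[of c] that by auto
      ultimately show ?thesis by simp
    qed
    then have "{i. 0 < i \<and> P (c \<circ> y) i} = {i. 0 < i \<and> P c i} \<union> {i. 0 < i \<and> P y i}"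
      by blast
    then show ?thesis
      using sub[of c] sub[of y] assms(2-4) by (metis (no_types, lifting) card_Un_disjoint disjoint_iff finite_subset subsetD)
  qed
  show "negs (c \<circ> y) = negs c + negs y"
    unfolding negs_def by (rule split) auto
  show "movs (c \<circ> y) = movs c + movs y"
    unfolding movs_def by (rule split) auto
qed

lemma negs_movs_id: "negs id = 0" "movs id = 0"
  by (simp_all add: negs_def movs_def cong: conj_cong)

lemma negs_movs_neg_cycle:
  assumes "0 < i"
  shows "negs (neg_cycle i) = 1" "movs (neg_cycle i) = 0"
proof -
  have "{k. 0 < k \<and> neg_cycle i k = - k} = {i}"
    using assms by (auto simp: neg_cycle_def)
  then show "negs (neg_cycle i) = 1"
    by (simp add: negs_def)
  show "movs (neg_cycle i) = 0"
    by (simp add: movs_def neg_cycle_def card_eq_0_iff)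
qed

lemma negs_movs_signed_transp:
  assumes "p \<noteq> 0" "q \<noteq> 0" "\<bar>p\<bar> \<noteq> \<bar>q\<bar>"
  shows "negs (signed_transp p q) = 0" "movs (signed_transp p q) = 2"
proof -
  have "{k. 0 < k \<and> signed_transp p q k = - k} = {}"
    using assms by (auto simp: signed_transp_def)
  then show "negs (signed_transp p q) = 0"
    unfolding negs_def by (simp only: card.empty)
  have "{k. 0 < k \<and> \<bar>signed_transp p q k\<bar> \<noteq> k} = {\<bar>p\<bar>, \<bar>q\<bar>}"
    using assms by (auto simp: signed_transp_def abs_if split: if_splits)
  then show "movs (signed_transp p q) = 2"
    using assms by (simp add: movs_def)
qed

section \<open>Inversions\<close>

text \<open>\<open>rinv (w i) (w j)\<close>, for \<open>i < j\<close>, is the number of those among the two roots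
  \<open>e\<^sub>j - e\<^sub>i\<close> and \<open>e\<^sub>j + e\<^sub>i\<close> that \<open>w\<close> sends to negative roots.\<close>

definition rinv :: "int \<Rightarrow> int \<Rightarrow> nat" where
  "rinv a b = (if \<bar>a\<bar> < b then 0 else if \<bar>a\<bar> < - b then 2 else 1)"

definition ord_pairs :: "int set \<Rightarrow> (int \<times> int) set" where
  "ord_pairs S = {(i, j). i \<in> S \<and> j \<in> S \<and> i < j}"

definition invs :: "int set \<Rightarrow> (int \<Rightarrow> int) \<Rightarrow> nat" where
  "invs S w = (\<Sum>(i, j) \<in> ord_pairs S. rinv (w i) (w j))"

text \<open>Changing the sign of \<open>w i\<close> merely exchanges the images of the two
  roots.\<close>

lemma rinv_abs: "rinv \<bar>a\<bar> b = rinv a b"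
  by (simp add: rinv_def)

lemma finite_ord_pairs: "finite S \<Longrightarrow> finite (ord_pairs S)"
  by (rule finite_subset[of _ "S \<times> S"]) (auto simp: ord_pairs_def)

lemma invs_cong: "(\<And>i. i \<in> S \<Longrightarrow> v i = w i) \<Longrightarrow> invs S v = invs S w"
  unfolding invs_def by (rule sum.cong) (auto simp: ord_pairs_def)

text \<open>The new point may lie anywhere in the order: it is the maximum in
  \<open>invs_insert_top\<close>, but the partner of the maximum in
  \<open>invs_glue_signed_transp\<close>.\<close>

lemma invs_insert:
  assumes "finite R" "j \<notin> R"
  shows "invs (insert j R) w =
    invs R w + (\<Sum>i\<in>R. if i < j then rinv (w i) (w j) else rinv (w j) (w i))"
proof -
  define f where "f i = (if i < j then (i, j) else (j, i))" for i
  have "ord_pairs (insert j R) = ord_pairs R \<union> f ` R"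
  proof -
    have "(a, b) \<in> ord_pairs (insert j R) \<longleftrightarrow> (a, b) \<in> ord_pairs R \<union> f ` R" for a b
      using assms(2) unfolding ord_pairs_def f_def image_iff
      by (cases "a = j"; cases "b = j") (auto split: if_splits)
    then show ?thesis by auto
  qed
  moreover have "ord_pairs R \<inter> f ` R = {}"
    using assms(2) by (auto simp: ord_pairs_def f_def split: if_splits)
  moreover have "inj_on f R"
    using assms(2) by (auto simp: inj_on_def f_def split: if_splits)
  ultimately show ?thesis
    unfolding invs_def using assms(1)
    by (simp add: sum.union_disjoint finite_ord_pairs sum.reindex)
       (rule sum.cong, auto simp: f_def)
qed

text \<open>The number of elements above \<open>j\<close> takes each value less than
  \<open>card R\<close> exactly once: a new minimum has all old elements above it and does not
  affect their counts.\<close>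

lemma sum_power_card_above:
  fixes R :: "'a :: linorder set" and x :: "'b :: comm_semiring_1"
  assumes "finite R"
  shows "(\<Sum>j\<in>R. x ^ card {i \<in> R. j < i}) = (\<Sum>r<card R. x ^ r)"
  using assms
proof (induction rule: finite_linorder_min_induct)
  case empty
  then show ?case by simp
next
  case (insert b A)
  have "{i \<in> insert b A. j < i} = {i \<in> A. j < i}" if "j \<in> A" for j
    using insert that by auto
  moreover have "{i \<in> insert b A. b < i} = A" "b \<notin> A"
    using insert by auto
  ultimately show ?case
    using insert by (simp add: add.commute)
qed

lemma sum_power_card_below:
  fixes R :: "'a :: linorder set" and x :: "'b :: comm_semiring_1"
  assumes "finite R"
  shows "(\<Sum>j\<in>R. x ^ card {i \<in> R. i < j}) = (\<Sum>r<card R. x ^ r)"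
  using assms
proof (induction rule: finite_linorder_max_induct)
  case empty
  then show ?case by simp
next
  case (insert b A)
  have "{i \<in> insert b A. i < j} = {i \<in> A. i < j}" if "j \<in> A" for j
    using insert that by auto
  moreover have "{i \<in> insert b A. i < b} = A" "b \<notin> A"
    using insert by auto
  ultimately show ?case
    using insert by (simp add: add.commute)
qed

lemma sum_if_less:
  fixes R :: "'a :: linorder set" and p q :: nat
  assumes "finite R"
  shows "(\<Sum>i\<in>R - {j}. if i < j then p else q) = p * card {i \<in> R. i < j} + q * card {i \<in> R. j < i}"
proof -
  have "(R - {j}) \<inter> {i. i < j} = {i \<in> R. i < j}" "(R - {j}) \<inter> - {i. i < j} = {i \<in> R. j < i}"
    by auto
  then show ?thesis
    using assms by (simp add: sum.If_cases)
qed

section \<open>The generating polynomial of signed involutions\<close>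

text \<open>The indices are integers so that \<open>m - 1\<close> and \<open>e - 1\<close> make
  sense at 0. The class is then empty, in accordance with the zero values of
  \<open>Dpoly\<close>.\<close>

definition invol_class :: "int set \<Rightarrow> int \<Rightarrow> int \<Rightarrow> (int \<Rightarrow> int) set" where
  "invol_class S m e = {x \<in> signed_invols S. int (movs x) = 2 * m \<and> int (negs x) = e}"

definition inv_poly :: "int set \<Rightarrow> int \<Rightarrow> int \<Rightarrow> int poly" where
  "inv_poly S m e = (\<Sum>x \<in> invol_class S m e. tX ^ invs S x)"

lemma finite_invol_class: "finite S \<Longrightarrow> finite (invol_class S m e)"
  by (simp add: invol_class_def finite_signed_invols)

lemma
  assumes "c \<in> signed_invols T" "y \<in> signed_invols (S - T)" "T \<subseteq> S" "finite S"
  shows negs_glue: "negs (c \<circ> y) = negs c + negs y"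
    and movs_glue: "movs (c \<circ> y) = movs c + movs y"
proof -
  have c: "c \<in> signed_perms T" and y: "y \<in> signed_perms (S - T)"
    using assms by (auto dest: signed_involsD)
  have "supp c \<inter> supp y = {}"
    using supp_signed_perms[OF c] supp_signed_perms[OF y] by auto
  moreover have "finite (supp c)" "finite (supp y)"
    using finite_supp[OF _ c] finite_supp[OF _ y] assms(3,4) by (simp_all add: finite_subset)
  ultimately show "negs (c \<circ> y) = negs c + negs y" "movs (c \<circ> y) = movs c + movs y"
    using signed_permsD(2)[OF y] by (auto intro: negs_comp movs_comp)
qed

text \<open>Composition with the cycle \<open>c\<close> through \<open>k\<close> maps a class on
  \<open>S - T\<close> bijectively onto the part of the class on \<open>S\<close> in which
  \<open>k\<close> has the value \<open>c k\<close>. It shifts inversions and both cycle counts by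
  constants. The assumption \<open>determined\<close> says that the value at \<open>k\<close>
  already fixes the whole cycle.\<close>

lemma inv_poly_fiber:
  assumes c: "c \<in> signed_invols T" and T: "T \<subseteq> S" "T \<subseteq> {0<..}" and S: "finite S" and k: "k \<in> T"
    and determined: "\<And>x i. x \<in> signed_invols S \<Longrightarrow> x k = c k \<Longrightarrow> i \<in> T \<Longrightarrow> x i = c i"
    and d: "\<And>y. y \<in> signed_invols (S - T) \<Longrightarrow> invs S (c \<circ> y) = d + invs (S - T) y"
    and m: "int (movs c) = 2 * (m - m')" and e: "int (negs c) = e - e'"
  shows "(\<Sum>x | x \<in> invol_class S m e \<and> x k = c k. tX ^ invs S x) =
    tX ^ d * inv_poly (S - T) m' e'"
proof -
  have glue: "bij_betw ((\<circ>) c) (signed_invols (S - T)) {x \<in> signed_invols S. \<forall>i \<in> T. x i = c i}"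
    by (rule bij_betw_glue[OF c T])
  have mem: "c \<circ> y \<in> invol_class S m e \<longleftrightarrow> y \<in> invol_class (S - T) m' e'"
    if "y \<in> signed_invols (S - T)" for y
    using that negs_glue[OF c that T(1) S] movs_glue[OF c that T(1) S] m e
      signed_invols_glue(2)[OF c T that]
    by (auto simp: invol_class_def)
  have "(\<circ>) c ` invol_class (S - T) m' e' = {x. x \<in> invol_class S m e \<and> x k = c k}"
  proof (intro equalityI subsetI)
    fix x assume "x \<in> (\<circ>) c ` invol_class (S - T) m' e'"
    then obtain y where y: "x = c \<circ> y" "y \<in> invol_class (S - T) m' e'"
      by blast
    moreover from this have "y \<in> signed_invols (S - T)"
      by (simp add: invol_class_def)
    ultimately show "x \<in> {x. x \<in> invol_class S m e \<and> x k = c k}"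
      using mem bij_betwE[OF glue] k by blast
  next
    fix x assume x: "x \<in> {x. x \<in> invol_class S m e \<and> x k = c k}"
    then have "x \<in> {x \<in> signed_invols S. \<forall>i \<in> T. x i = c i}"
      using determined by (auto simp: invol_class_def)
    then obtain y where "x = c \<circ> y" "y \<in> signed_invols (S - T)"
      using bij_betw_imp_surj_on[OF glue] by blast
    then show "x \<in> (\<circ>) c ` invol_class (S - T) m' e'"
      using x mem by blast
  qed
  then have "bij_betw ((\<circ>) c) (invol_class (S - T) m' e') {x. x \<in> invol_class S m e \<and> x k = c k}"
    by (intro bij_betw_subset[OF glue]) (auto simp: invol_class_def)
  then have "(\<Sum>x | x \<in> invol_class S m e \<and> x k = c k. tX ^ invs S x) =
      (\<Sum>y \<in> invol_class (S - T) m' e'. tX ^ invs S (c \<circ> y))"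
    by (rule sum.reindex_bij_betw[symmetric])
  also have "\<dots> = (\<Sum>y \<in> invol_class (S - T) m' e'. tX ^ d * tX ^ invs (S - T) y)"
    by (rule sum.cong) (auto simp: invol_class_def d power_add)
  finally show ?thesis
    by (simp add: inv_poly_def sum_distrib_left)
qed

lemma signed_invols_abs_less:
  assumes "y \<in> signed_invols R" "R \<subseteq> {0<..<k}" "i \<in> R"
  shows "\<bar>y i\<bar> < k"
proof -
  have "0 < i" using assms by auto
  then show ?thesis
    using signed_involsD(5)[OF assms(1), of i] assms(2,3) by (auto dest: subsetD)
qed

lemma invs_insert_top:
  assumes "finite R" "R \<subseteq> {0<..<k}"
  shows "invs (insert k R) w = invs R w + (\<Sum>i\<in>R. rinv (w i) (w k))"
proof -
  have "k \<notin> R" and "\<And>i. i \<in> R \<Longrightarrow> i < k"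
    using assms(2) by auto
  then show ?thesis
    using assms(1) by (simp add: invs_insert)
qed

text \<open>The value at the top point \<open>k\<close> exceeds all other absolute values, so no
  pair with \<open>k\<close> contributes.\<close>

lemma invs_glue_id:
  assumes R: "finite R" "R \<subseteq> {0<..<k}" and k: "0 < k" and y: "y \<in> signed_invols R"
  shows "invs (insert k R) (id \<circ> y) = invs R y"
proof -
  have "k \<notin> R" using R by auto
  then have "y k = k"
    using signed_involsD(4)[OF y, of k] k by simp
  then show ?thesis
    using signed_invols_abs_less[OF y R(2)] by (simp add: invs_insert_top[OF R] rinv_def)
qed

text \<open>The value at \<open>k\<close> is below the negatives of all other absolute values, so
  every pair with \<open>k\<close> contributes 2.\<close>

lemma invs_glue_neg_cycle:
  assumes R: "finite R" "R \<subseteq> {0<..<k}" and k: "0 < k" and y: "y \<in> signed_invols R"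
  shows "invs (insert k R) (neg_cycle k \<circ> y) = 2 * card R + invs R y"
proof -
  let ?x = "neg_cycle k \<circ> y"
  have kR: "k \<notin> R" using R by auto
  have x: "?x = (\<lambda>i. if \<bar>i\<bar> \<in> {k} then neg_cycle k i else y i)"
    using k kR y by (intro signed_invols_glue(1)[where S = "insert k R"] neg_cycle_signed_invols) auto
  have xk: "?x k = - k"
    unfolding x using k by (simp add: neg_cycle_def)
  have xR: "?x i = y i" if "i \<in> R" for i
    using that R kR by (auto simp: x)
  have "(\<Sum>i\<in>R. rinv (?x i) (?x k)) = (\<Sum>i\<in>R. 2)"
  proof (rule sum.cong[OF refl])
    fix i assume "i \<in> R"
    then show "rinv (?x i) (?x k) = 2"
      using signed_invols_abs_less[OF y R(2), of i] unfolding xk xR[OF \<open>i \<in> R\<close>]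
      by (simp add: rinv_def)
  qed
  then show ?thesis
    using invs_cong[of R ?x y] xR unfolding invs_insert_top[OF R] by simp
qed

text \<open>The additional pairs are those with \<open>k\<close>, whose value is \<open>v\<close>,
  and those with \<open>\<bar>v\<bar>\<close>, whose value is \<open>k\<close> or
  \<open>- k\<close>. A third point above \<open>\<bar>v\<bar>\<close> contributes 1 to each of the
  two sums; one below contributes 0 to each if \<open>v\<close> is positive and 2 to each if
  \<open>v\<close> is negative. The pair of \<open>\<bar>v\<bar>\<close> and \<open>k\<close> itself
  contributes 1.\<close>

lemma invs_glue_signed_transp:
  assumes R: "finite R" "R \<subseteq> {0<..<k}" and v: "\<bar>v\<bar> \<in> R" and y: "y \<in> signed_invols (R - {\<bar>v\<bar>})"
  shows "invs (insert k R) (signed_transp k v \<circ> y) =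
    1 + 2 * card {i \<in> R. \<bar>v\<bar> < i} + (if 0 < v then 0 else 4 * card {i \<in> R. i < \<bar>v\<bar>})
      + invs (R - {\<bar>v\<bar>}) y"
proof -
  let ?x = "signed_transp k v \<circ> y" and ?R = "R - {\<bar>v\<bar>}"
  have "0 < \<bar>v\<bar>" "\<bar>v\<bar> < k" "k \<notin> R"
    using R v by auto
  then have kv: "0 < k" "v \<noteq> 0" "\<bar>v\<bar> < k" "k \<notin> R"
    by simp_all
  have x: "?x = (\<lambda>i. if \<bar>i\<bar> \<in> {\<bar>k\<bar>, \<bar>v\<bar>} then signed_transp k v i else y i)"
  proof (rule signed_invols_glue(1)[where S = "insert k R"])
    have "insert k R - {\<bar>k\<bar>, \<bar>v\<bar>} = ?R"
      using kv by auto
    then show "y \<in> signed_invols (insert k R - {\<bar>k\<bar>, \<bar>v\<bar>})"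
      using y by simp
    show "signed_transp k v \<in> signed_invols {\<bar>k\<bar>, \<bar>v\<bar>}"
      using kv by (intro signed_transp_signed_invols) auto
  qed (use kv v in auto)
  have xk: "?x k = v"
    unfolding x using kv by (simp add: signed_transp_def)
  have xv: "?x \<bar>v\<bar> = (if 0 < v then k else - k)"
    unfolding x using kv by (simp add: signed_transp_def abs_if)
  have xR: "?x i = y i" if "i \<in> ?R" for i
    using that R kv by (auto simp: x)
  \<comment> \<open>Only \<open>\<bar>y i\<bar>\<close> matters, and these absolute values are a
    rearrangement of \<open>?R\<close>; hence the sum does not depend on \<open>y\<close>.\<close>
  have "(\<Sum>i\<in>?R. rinv (y i) v) = (\<Sum>i\<in>?R. rinv \<bar>y i\<bar> v)"
    by (simp add: rinv_abs)
  also have "\<dots> = (\<Sum>i\<in>?R. rinv i v)"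
    using signed_involsD(1)[OF y] R
    by (intro sum.reindex_bij_betw signed_perms_bij_betw_abs) auto
  also have "\<dots> = (\<Sum>i\<in>?R. if i < \<bar>v\<bar> then (if 0 < v then 0 else 2) else 1)"
  proof (rule sum.cong[OF refl])
    fix i assume "i \<in> ?R"
    then have "0 < i" "i \<noteq> \<bar>v\<bar>" using R by auto
    then show "rinv i v = (if i < \<bar>v\<bar> then (if 0 < v then 0 else 2) else 1)"
      by (auto simp: rinv_def)
  qed
  also have "\<dots> = (if 0 < v then 0 else 2) * card {i \<in> R. i < \<bar>v\<bar>} + card {i \<in> R. \<bar>v\<bar> < i}"
    using R by (simp add: sum_if_less)
  finally have sum_k: "(\<Sum>i\<in>?R. rinv (?x i) (?x k)) =
      (if 0 < v then 0 else 2) * card {i \<in> R. i < \<bar>v\<bar>} + card {i \<in> R. \<bar>v\<bar> < i}"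
    using xk xR by simp
  \<comment> \<open>Here the value \<open>k\<close> or \<open>- k\<close> dominates every
    \<open>y i\<close>, so only the relative position of \<open>i\<close> and
    \<open>\<bar>v\<bar>\<close> and the sign of \<open>v\<close> count.\<close>
  have "(\<Sum>i\<in>?R. if i < \<bar>v\<bar> then rinv (?x i) (?x \<bar>v\<bar>) else rinv (?x \<bar>v\<bar>) (?x i)) =
      (\<Sum>i\<in>?R. if i < \<bar>v\<bar> then (if 0 < v then 0 else 2) else 1)"
  proof (rule sum.cong[OF refl])
    fix i assume i: "i \<in> ?R"
    have "\<bar>y i\<bar> < k"
      using signed_invols_abs_less[OF y _ i] R by auto
    then show "(if i < \<bar>v\<bar> then rinv (?x i) (?x \<bar>v\<bar>) else rinv (?x \<bar>v\<bar>) (?x i)) =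
        (if i < \<bar>v\<bar> then (if 0 < v then 0 else 2) else 1)"
      unfolding xv xR[OF i] by (auto simp: rinv_def)
  qed
  also have "\<dots> = (if 0 < v then 0 else 2) * card {i \<in> R. i < \<bar>v\<bar>} + card {i \<in> R. \<bar>v\<bar> < i}"
    using R by (simp add: sum_if_less)
  finally have sum_v: "invs R ?x = invs ?R y +
      ((if 0 < v then 0 else 2) * card {i \<in> R. i < \<bar>v\<bar>} + card {i \<in> R. \<bar>v\<bar> < i})"
    using invs_insert[of ?R "\<bar>v\<bar>" ?x] R v invs_cong[of ?R ?x y] xR by (simp add: insert_absorb)
  have "rinv (?x \<bar>v\<bar>) (?x k) = 1"
    unfolding xk xv using kv by (auto simp: rinv_def)
  then have "(\<Sum>i\<in>R. rinv (?x i) (?x k)) = 1 + (\<Sum>i\<in>?R. rinv (?x i) (?x k))"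
    using R v by (simp add: sum.remove)
  then show ?thesis
    unfolding invs_insert_top[OF R] sum_v sum_k by simp
qed

text \<open>The involutions are grouped by their value at \<open>k\<close>, and each group is
  evaluated by \<open>inv_poly_fiber\<close>. The two powers belonging to \<open>j\<close> come from
  the values \<open>j\<close> and \<open>- j\<close>.\<close>

lemma inv_poly_insert:
  assumes R: "finite R" "R \<subseteq> {0<..<k}" and k: "0 < k"
  shows "inv_poly (insert k R) m e =
    inv_poly R m e + tX ^ (2 * card R) * inv_poly R m (e - 1) +
    (\<Sum>j\<in>R. (tX ^ (1 + 2 * card {i \<in> R. j < i}) +
              tX ^ (1 + 2 * card {i \<in> R. j < i} + 4 * card {i \<in> R. i < j})) *
             inv_poly (R - {j}) (m - 1) e)"
proof -
  let ?S = "insert k R"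
  let ?f = "\<lambda>x. tX ^ invs ?S x" and ?A = "invol_class ?S m e"
  let ?h = "\<lambda>v. \<Sum>x | x \<in> ?A \<and> x k = v. ?f x"
  have kR: "k \<notin> R" "- k \<notin> R" and posR: "\<And>j. j \<in> R \<Longrightarrow> 0 < j" "\<And>j. j \<in> R \<Longrightarrow> j < k"
    using R k by auto
  have S: "finite ?S" "?S - {k} = R"
    using R kR by auto
  have "(\<lambda>x. x k) ` ?A \<subseteq> insert k (insert (- k) (R \<union> uminus ` R))"
  proof clarify
    fix x assume "x \<in> ?A" and x: "x k \<noteq> k" "x k \<noteq> - k" "x k \<notin> uminus ` R"
    then have "\<bar>x k\<bar> \<in> ?S"
      using k signed_involsD(5)[of x ?S k] by (simp add: invol_class_def)
    moreover have "- x k \<notin> R"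
      using x(3) by (auto intro: image_eqI[of _ uminus "- x k"])
    ultimately show "x k \<in> R"
      using x by (auto simp: abs_if split: if_splits)
  qed
  then have "inv_poly ?S m e = (\<Sum>v \<in> insert k (insert (- k) (R \<union> uminus ` R)). ?h v)"
    unfolding inv_poly_def using R by (intro sum.group[symmetric]) (auto simp: finite_invol_class)
  also have "\<dots> = ?h k + ?h (- k) + (sum ?h R + sum ?h (uminus ` R))"
  proof -
    have "0 < - j" if "j \<in> uminus ` R" for j
      using that posR(1) by auto
    then have "k \<notin> insert (- k) (R \<union> uminus ` R)" "- k \<notin> R \<union> uminus ` R" "R \<inter> uminus ` R = {}"
      using k kR posR(1) by fastforce+
    then show ?thesis
      using R by (simp add: sum.union_disjoint add.assoc)
  qed
  also have "sum ?h (uminus ` R) = (\<Sum>j\<in>R. ?h (- j))"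
    by (simp add: sum.reindex inj_on_def)
  also have "sum ?h R + (\<Sum>j\<in>R. ?h (- j)) = (\<Sum>j\<in>R. ?h j + ?h (- j))"
    by (simp add: sum.distrib)
  also have "?h k = inv_poly R m e"
    using inv_poly_fiber[of id "{k}" ?S k 0 m m e e] S k invs_glue_id[OF R k]
    by (simp add: signed_involsI negs_movs_id)
  also have "?h (- k) = tX ^ (2 * card R) * inv_poly R m (e - 1)"
  proof -
    have "neg_cycle k k = - k"
      by (simp add: neg_cycle_def)
    then show ?thesis
      using inv_poly_fiber[OF neg_cycle_signed_invols[OF k], of ?S k "2 * card R" m m e "e - 1"]
        S k invs_glue_neg_cycle[OF R k]
      by (simp add: negs_movs_neg_cycle)
  qed
  also have h: "?h v = tX ^ (1 + 2 * card {i \<in> R. \<bar>v\<bar> < i} +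
        (if 0 < v then 0 else 4 * card {i \<in> R. i < \<bar>v\<bar>})) * inv_poly (R - {\<bar>v\<bar>}) (m - 1) e"
    if v: "\<bar>v\<bar> \<in> R" for v
  proof -
    let ?c = "signed_transp k v"
    have kv: "k \<noteq> 0" "v \<noteq> 0" "\<bar>k\<bar> \<noteq> \<bar>v\<bar>" "?c k = v" "?c v = k" "?S - {k, \<bar>v\<bar>} = R - {\<bar>v\<bar>}"
      using k kR posR(1)[OF v] v by (auto simp: signed_transp_def)
    have "?h (?c k) = tX ^ (1 + 2 * card {i \<in> R. \<bar>v\<bar> < i} +
        (if 0 < v then 0 else 4 * card {i \<in> R. i < \<bar>v\<bar>})) * inv_poly (?S - {\<bar>k\<bar>, \<bar>v\<bar>}) (m - 1) e"
    proof (rule inv_poly_fiber[OF signed_transp_signed_invols[OF kv(1-3)]])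
      show "invs ?S (?c \<circ> y) = 1 + 2 * card {i \<in> R. \<bar>v\<bar> < i} +
          (if 0 < v then 0 else 4 * card {i \<in> R. i < \<bar>v\<bar>}) + invs (?S - {\<bar>k\<bar>, \<bar>v\<bar>}) y"
        if "y \<in> signed_invols (?S - {\<bar>k\<bar>, \<bar>v\<bar>})" for y
        using that k kv(6) invs_glue_signed_transp[OF R v, of y] by simp
      show "x i = ?c i" if x: "x \<in> signed_invols ?S" "x k = ?c k" and i: "i \<in> {\<bar>k\<bar>, \<bar>v\<bar>}" for x i
      proof -
        \<comment> \<open>As \<open>x\<close> is an odd involution, its value \<open>v\<close> at
          \<open>k\<close> determines it on the whole transposition.\<close>
        have "x v = k"
          using signed_involsD(2)[OF x(1), of k] x(2) kv by simp
        moreover from this have "x (- v) = - k"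
          using signed_involsD(3)[OF x(1), of v] by simp
        moreover have "?c (- v) = - k"
          using kv by (auto simp: signed_transp_def)
        ultimately show ?thesis
          using i x(2) k kv(5) by (auto simp: abs_if split: if_splits)
      qed
    qed (use k kv v S negs_movs_signed_transp[OF kv(1-3)] posR(1)[OF v] in auto)
    then show ?thesis
      using k kv by simp
  qed
  have "(\<Sum>j\<in>R. ?h j + ?h (- j)) =
    (\<Sum>j\<in>R. (tX ^ (1 + 2 * card {i \<in> R. j < i}) +
              tX ^ (1 + 2 * card {i \<in> R. j < i} + 4 * card {i \<in> R. i < j})) *
             inv_poly (R - {j}) (m - 1) e)"
  proof (rule sum.cong[OF refl])
    fix j assume "j \<in> R"
    then show "?h j + ?h (- j) = (tX ^ (1 + 2 * card {i \<in> R. j < i}) +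
              tX ^ (1 + 2 * card {i \<in> R. j < i} + 4 * card {i \<in> R. i < j})) *
             inv_poly (R - {j}) (m - 1) e"
      using h[of j] h[of "- j"] posR(1)[of j] by (simp add: distrib_right)
  qed
  finally show ?thesis .
qed

text \<open>With the quotient in \<open>Dcoef\<close> written as a geometric sum, the recursion also
  produces the prescribed values for \<open>n = 1\<close> and \<open>n = 2\<close>, so the count
  needs no base case but the empty set. The truncated exponent \<open>2 * n - 4\<close> is harmless:
  for \<open>n = 1\<close> the sum is empty, and for \<open>n = 2\<close> the factor becomes
  2.\<close>

lemma Dpoly_uniform_rec:
  assumes "1 \<le> n"
  shows "Dpoly n m e = Dpoly (n - 1) m e + tX ^ (2 * n - 2) * Dpoly (n - 1) m (e - 1)
    + tX * (1 + tX ^ (2 * n - 4)) * (\<Sum>r<n - 1. tX ^ (2 * r)) * Dpoly (n - 2) (m - 1) e"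
proof -
  consider "m < 0 \<or> e < 0" | "0 \<le> m" "0 \<le> e" "3 \<le> n" | "0 \<le> m" "0 \<le> e" "n = 1 \<or> n = 2"
    using assms by linarith
  then show ?thesis
  proof cases
    case 1
    then show ?thesis by (auto simp: Dpoly_eq_0)
  next
    case 2
    have "(tX ^ 2 - 1) * (\<Sum>r<n - 1. tX ^ (2 * r)) = tX ^ (2 * n - 2) - 1"
    proof -
      have "2 * n - 2 = 2 * (n - 1)" by simp
      then show ?thesis
        using power_diff_1_eq[of "tX ^ 2" "n - 1"] by (simp only: power_mult)
    qed
    with Dcoef_exact[OF assms]
    have "Dcoef n * (tX ^ 2 - 1) =
        tX * (1 + tX ^ (2 * n - 4)) * ((tX ^ 2 - 1) * (\<Sum>r<n - 1. tX ^ (2 * r)))"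
      by (simp only:)
    then have "Dcoef n * (tX ^ 2 - 1) =
        tX * (1 + tX ^ (2 * n - 4)) * (\<Sum>r<n - 1. tX ^ (2 * r)) * (tX ^ 2 - 1)"
      by (simp only: mult_ac)
    \<comment> \<open>The divisor takes the value -1 at 0, so it is not the zero polynomial and can
      be cancelled.\<close>
    moreover have "poly (tX ^ 2 - 1) 0 \<noteq> 0"
      by simp
    then have "tX ^ 2 - 1 \<noteq> 0"
      by (metis poly_0)
    ultimately have "Dcoef n = tX * (1 + tX ^ (2 * n - 4)) * (\<Sum>r<n - 1. tX ^ (2 * r))"
      using mult_right_cancel by blast
    then show ?thesis
      using Dpoly_rec[OF 2(3,1,2)] by simp
  next
    case 3
    show ?thesis
    proof (cases "2 * m + e \<le> int n")
      case False
      then have "Dpoly n m e = 0" "Dpoly (n - 1) m e = 0" "Dpoly (n - 1) m (e - 1) = 0"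
        using 3 by (auto intro!: Dpoly_eq_0)
      \<comment> \<open>For \<open>n = 1\<close>, \<open>m = 1\<close>, \<open>e = 0\<close> the
        truncated index turns the last factor into \<open>Dpoly 0 0 0 = 1\<close>; there the empty
        sum removes the term.\<close>
      moreover have "n - 1 = 0 \<or> Dpoly (n - 2) (m - 1) e = 0"
        using 3 False by (auto intro!: Dpoly_eq_0)
      ultimately show ?thesis by auto
    next
      case True
      then consider "m = 0" "e = 0" | "m = 0" "e = 1" | "n = 2" "m = 0" "e = 2" | "n = 2" "m = 1" "e = 0"
        using 3 by linarith
      then show ?thesis
      proof cases
        case 1
        then show ?thesis by (simp add: Dpoly_0_0 Dpoly_eq_0)
      next
        case 2
        then show ?thesis
          using 3(3) Dpoly_initial(1,3) by (auto simp: Dpoly_0_0 Dpoly_eq_0)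
      next
        case 3
        then show ?thesis
          using Dpoly_initial(1,4) by (simp add: Dpoly_0_0 Dpoly_eq_0)
      next
        case 4
        then show ?thesis
          using Dpoly_initial(2) by (simp add: Dpoly_0_0 Dpoly_eq_0)
      qed
    qed
  qed
qed

theorem inv_poly_eq_Dpoly:
  assumes "finite S" "S \<subseteq> {0<..}"
  shows "inv_poly S m e = Dpoly (card S) m e"
  using assms
proof (induction "card S" arbitrary: S m e rule: less_induct)
  case less
  show ?case
  proof (cases "S = {}")
    case True
    have "x = id" if "x \<in> signed_invols {}" for x
      using signed_involsD(4)[OF that] by auto
    then have "signed_invols {} = {id}"
      by (auto simp: signed_involsI)
    then have "invol_class {} m e = (if m = 0 \<and> e = 0 then {id} else {})"
      by (auto simp: invol_class_def negs_movs_id)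
    then have "inv_poly {} m e = (if m = 0 \<and> e = 0 then 1 else 0)"
      by (simp add: inv_poly_def invs_def ord_pairs_def)
    \<comment> \<open>These values for the empty set are the ones that
      \<open>Dpoly_uniform_rec\<close> refers to at \<open>n = 1\<close> and
      \<open>n = 2\<close>.\<close>
    moreover have "Dpoly 0 m e = (if m = 0 \<and> e = 0 then 1 else 0)"
    proof (cases "0 < 2 * m + e \<or> m < 0 \<or> e < 0")
      case True
      then show ?thesis
        using Dpoly_eq_0[of 0 m e] by auto
    next
      case False
      then have "m = 0" "e = 0" by linarith+
      then show ?thesis by (simp add: Dpoly_0_0)
    qed
    ultimately show ?thesis
      using True by simp
  next
    case False
    define k R where "k = Max S" and "R = S - {k}"
    have k: "k \<in> S" "0 < k"
      using less.prems False by (auto simp: k_def dest: Max_in)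
    have R: "finite R" "R \<subseteq> {0<..<k}" "S = insert k R" "k \<notin> R"
    proof -
      show "finite R" "S = insert k R" "k \<notin> R"
        using less.prems k by (auto simp: R_def)
      have "i \<le> k" if "i \<in> S" for i
        using that less.prems(1) by (simp add: k_def)
      then show "R \<subseteq> {0<..<k}"
        using less.prems(2) by (auto simp: R_def order_less_le)
    qed
    have R0: "R \<subseteq> {0<..}"
      using R(2) by auto
    define n where "n = card S"
    have n: "n = Suc (card R)"
      using R by (simp add: n_def)
    have IH1: "inv_poly R m' e' = Dpoly (n - 1) m' e'" for m' e'
      using less.hyps[of R m' e'] R(1) R0 n n_def by auto
    have IH2: "inv_poly (R - {j}) m' e' = Dpoly (n - 2) m' e'" if "j \<in> R" for j m' e'
      using less.hyps[of "R - {j}" m' e'] R(1) n n_def that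
        subset_trans[OF Diff_subset R0] by (simp add: numeral_2_eq_2)
    \<comment> \<open>Besides \<open>j\<close>, the set \<open>R\<close> has \<open>n - 2\<close>
      elements, each above or below \<open>j\<close>. As \<open>R\<close> contains \<open>j\<close>,
      \<open>n\<close> is at least 2 and \<open>2 * n - 4\<close> is a true difference.\<close>
    have exps: "1 + 2 * card {i \<in> R. j < i} + 4 * card {i \<in> R. i < j} =
        1 + (2 * n - 4) + 2 * card {i \<in> R. i < j}" if "j \<in> R" for j
    proof -
      have "R = insert j ({i \<in> R. i < j} \<union> {i \<in> R. j < i})"
        using that by auto
      then have "card R = Suc (card ({i \<in> R. i < j} \<union> {i \<in> R. j < i}))"
        using R(1) by (metis (no_types, lifting) card_insert_disjoint UnE finite_insert finite_subset mem_Collect_eq order_less_irrefl subset_insertI)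
      also have "\<dots> = Suc (card {i \<in> R. i < j} + card {i \<in> R. j < i})"
        using R(1) by (subst card_Un_disjoint) auto
      finally show ?thesis using n by simp
    qed
    have step: "(tX ^ (1 + 2 * card {i \<in> R. j < i}) +
          tX ^ (1 + 2 * card {i \<in> R. j < i} + 4 * card {i \<in> R. i < j})) * inv_poly (R - {j}) (m - 1) e =
        tX * ((tX ^ 2) ^ card {i \<in> R. j < i} + tX ^ (2 * n - 4) * (tX ^ 2) ^ card {i \<in> R. i < j}) *
          Dpoly (n - 2) (m - 1) e" if "j \<in> R" for j
      unfolding exps[OF that] IH2[OF that]
      by (simp only: power_add power_mult power_one_right distrib_left mult.assoc)
    have "2 * card R = 2 * n - 2"
      using n by simp
    then have "inv_poly S m e = Dpoly (n - 1) m e + tX ^ (2 * n - 2) * Dpoly (n - 1) m (e - 1) +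
      (\<Sum>j\<in>R. tX * ((tX ^ 2) ^ card {i \<in> R. j < i} + tX ^ (2 * n - 4) * (tX ^ 2) ^ card {i \<in> R. i < j})) *
        Dpoly (n - 2) (m - 1) e"
      unfolding R(3) inv_poly_insert[OF R(1,2) k(2)] sum_distrib_right IH1
      by (simp only: step cong: sum.cong)
    \<comment> \<open>The counts above \<open>j\<close> and the counts below \<open>j\<close> each
      run through all exponents once, so both signs give the same geometric sum.\<close>
    also have "(\<Sum>j\<in>R. tX * ((tX ^ 2) ^ card {i \<in> R. j < i} + tX ^ (2 * n - 4) * (tX ^ 2) ^ card {i \<in> R. i < j})) =
        tX * (1 + tX ^ (2 * n - 4)) * (\<Sum>r<n - 1. tX ^ (2 * r))"
    proof -
      have "(\<Sum>j\<in>R. tX * ((tX ^ 2) ^ card {i \<in> R. j < i} + tX ^ (2 * n - 4) * (tX ^ 2) ^ card {i \<in> R. i < j})) =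
          tX * (\<Sum>r<n - 1. (tX ^ 2) ^ r) + tX * (tX ^ (2 * n - 4) * (\<Sum>r<n - 1. (tX ^ 2) ^ r))"
        unfolding n diff_Suc_1 distrib_left sum.distrib
        unfolding sum_distrib_left[symmetric] sum_power_card_above[OF R(1)] sum_power_card_below[OF R(1)] ..
      then show ?thesis
        by (simp only: power_mult distrib_left distrib_right mult_1_right mult.assoc)
    qed
    also have "Dpoly (n - 1) m e + tX ^ (2 * n - 2) * Dpoly (n - 1) m (e - 1) +
        tX * (1 + tX ^ (2 * n - 4)) * (\<Sum>r<n - 1. tX ^ (2 * r)) * Dpoly (n - 2) (m - 1) e = Dpoly n m e"
      using Dpoly_uniform_rec[of n m e] n by simp
    finally show ?thesis
      by (simp add: n_def)
  qed
qed

section \<open>Length and inversions\<close>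

lemma atLeastAtMost_1_subset_pos [simp]: "{1..int n} \<subseteq> {0<..}"
  by auto

text \<open>The pair \<open>(p, q)\<close> encodes the simple root \<open>e\<^sub>q - e\<^sub>p\<close>; in particular
  \<open>(- 1, 2)\<close> encodes \<open>e\<^sub>1 + e\<^sub>2\<close>.\<close>

definition simple_pairs :: "nat \<Rightarrow> (int \<times> int) set" where
  "simple_pairs n = {(i, i + 1) | i. 1 \<le> i \<and> i < int n} \<union> (if n \<ge> 2 then {(- 1, 2)} else {})"

lemma simple_pairs_cases:
  assumes "(p, q) \<in> simple_pairs n"
  obtains "1 \<le> p" "q = p + 1" "q \<le> int n" | "p = - 1" "q = 2" "2 \<le> int n"
  using assms by (auto simp: simple_pairs_def split: if_splits)

lemma simple_pairs_abs:
  assumes "(p, q) \<in> simple_pairs n"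
  shows "p \<noteq> 0" "q \<noteq> 0" "\<bar>p\<bar> \<noteq> \<bar>q\<bar>" "\<bar>p\<bar> \<in> {1..int n}" "\<bar>q\<bar> \<in> {1..int n}"
  using assms by (auto elim!: simple_pairs_cases)

lemma signed_transp_simps:
  assumes "p \<noteq> 0" "q \<noteq> 0" "\<bar>p\<bar> \<noteq> \<bar>q\<bar>"
  shows "signed_transp p q p = q" "signed_transp p q (- p) = - q"
    "signed_transp p q q = p" "signed_transp p q (- q) = - p"
    "\<bar>x\<bar> \<noteq> \<bar>p\<bar> \<Longrightarrow> \<bar>x\<bar> \<noteq> \<bar>q\<bar> \<Longrightarrow> signed_transp p q x = x"
  using assms by (auto simp: signed_transp_def)

lemma signed_transp_abs:
  assumes "p \<noteq> 0" "q \<noteq> 0" "\<bar>p\<bar> \<noteq> \<bar>q\<bar>"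
  shows "signed_transp p q \<bar>p\<bar> = sgn p * q" "signed_transp p q \<bar>q\<bar> = sgn q * p"
  using signed_transp_simps(1-4)[OF assms] assms(1,2)
  by (cases p "0 :: int" rule: linorder_cases; cases q "0 :: int" rule: linorder_cases; simp)+

lemma rinv_minus_left: "rinv (- x) y = rinv x y"
  by (simp add: rinv_def)

section \<open>The effect of a simple reflection on inversions\<close>

text \<open>The absolute values of \<open>p\<close> and \<open>q\<close> are consecutive, so no
  third absolute value separates them. For the pair \<open>(- 1, 2)\<close> this forces
  \<open>\<bar>z\<bar>\<close> to exceed 2, which makes the sign of \<open>p\<close>
  irrelevant.\<close>

lemma rinv_simple_pair:
  assumes "(p, q) \<in> simple_pairs n" "z \<noteq> 0" "\<bar>z\<bar> \<noteq> \<bar>p\<bar>" "\<bar>z\<bar> \<noteq> \<bar>q\<bar>"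
  shows "rinv q z = rinv p z" "rinv z q = rinv z p" "rinv z (- q) = rinv z (- p)"
proof -
  have pq: "\<bar>q\<bar> = \<bar>p\<bar> + 1" "0 < q" "p = - 1 \<or> 0 < p"
    using assms(1) by (auto elim!: simple_pairs_cases)
  then have z: "0 < p \<and> \<bar>z\<bar> < \<bar>p\<bar> \<or> \<bar>q\<bar> < \<bar>z\<bar>"
    using assms(2-4) by linarith
  show "rinv q z = rinv p z"
    using z pq(1) unfolding rinv_def by (cases "z < 0") auto
  show "rinv z q = rinv z p" "rinv z (- q) = rinv z (- p)"
    using z pq unfolding rinv_def by auto
qed

text \<open>This reflects the fact that a simple reflection permutes the positive roots other than
  its own: at most one entry is moved, and the other cannot tell \<open>p\<close> from
  \<open>q\<close>.\<close>

lemma rinv_signed_transp_eq: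
  assumes pq: "(p, q) \<in> simple_pairs n" and "x \<noteq> 0" "y \<noteq> 0" "\<bar>x\<bar> \<noteq> \<bar>y\<bar>"
    "{\<bar>x\<bar>, \<bar>y\<bar>} \<noteq> {\<bar>p\<bar>, \<bar>q\<bar>}"
  shows "rinv (signed_transp p q x) (signed_transp p q y) = rinv x y"
proof -
  note s = signed_transp_simps[OF simple_pairs_abs(1-3)[OF pq]]
  let ?away = "\<lambda>z. \<bar>z\<bar> \<noteq> \<bar>p\<bar> \<and> \<bar>z\<bar> \<noteq> \<bar>q\<bar>"
  have near: "z = p \<or> z = - p \<or> z = q \<or> z = - q" if "\<not> ?away z" for z
    using that by linarith
  consider "?away x" "?away y" | "\<not> ?away x" "?away y" | "?away x" "\<not> ?away y"
    using assms(4,5) unfolding doubleton_eq_iff by metis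
  then show ?thesis
  proof cases
    case 1
    then show ?thesis by (simp add: s(5))
  next
    case 2
    then have "signed_transp p q y = y" "rinv q y = rinv p y"
      using s(5) rinv_simple_pair(1)[OF pq assms(3)] by auto
    then show ?thesis
      using near[OF 2(1)] by (auto simp: s(1-4) rinv_minus_left)
  next
    case 3
    then have "signed_transp p q x = x" "rinv x q = rinv x p" "rinv x (- q) = rinv x (- p)"
      using s(5) rinv_simple_pair(2,3)[OF pq assms(2)] by auto
    then show ?thesis
      using near[OF 3(2)] by (auto simp: s(1-4))
  qed
qed

lemma rinv_simple_pair_values:
  assumes "(p, q) \<in> simple_pairs n"
  shows "rinv p q = 0" "rinv p (- q) = 2" "rinv q p = 1" "rinv q (- p) = 1"
  using assms by (auto simp: rinv_def elim!: simple_pairs_cases)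

text \<open>On the remaining pair the reflection negates one of the two roots and fixes the other,
  so the count changes by one.\<close>

lemma rinv_signed_transp_le:
  assumes pq: "(p, q) \<in> simple_pairs n" and xy: "{\<bar>x\<bar>, \<bar>y\<bar>} = {\<bar>p\<bar>, \<bar>q\<bar>}"
  shows "rinv (signed_transp p q x) (signed_transp p q y) \<le> rinv x y + 1"
proof -
  have "(x = p \<or> x = - p) \<and> (y = q \<or> y = - q) \<or> (x = q \<or> x = - q) \<and> (y = p \<or> y = - p)"
    using xy by (simp add: doubleton_eq_iff abs_eq_iff)
  then show ?thesis
    by (elim disjE conjE) (simp_all add: signed_transp_simps simple_pairs_abs[OF pq]
        rinv_minus_left rinv_simple_pair_values[OF pq])
qed

lemma rinv_signed_transp_less:
  assumes pq: "(p, q) \<in> simple_pairs n" and xy: "\<bar>x\<bar> = \<bar>p\<bar> \<and> y = - q \<or> \<bar>x\<bar> = \<bar>q\<bar> \<and> y = p"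
  shows "rinv (signed_transp p q x) (signed_transp p q y) < rinv x y"
proof -
  have "(x = p \<or> x = - p) \<and> y = - q \<or> (x = q \<or> x = - q) \<and> y = p"
    using xy by (simp add: abs_eq_iff)
  then show ?thesis
    by (elim disjE conjE) (simp_all add: signed_transp_simps simple_pairs_abs[OF pq]
        rinv_minus_left rinv_simple_pair_values[OF pq])
qed

text \<open>\<open>a\<close> and \<open>b\<close> are the positions where \<open>w\<close> takes the
  values \<open>p\<close> and \<open>q\<close> up to sign, and theirs is the only pair whose
  contribution can change. The additive form avoids subtraction of natural numbers.\<close>

lemma invs_left_mult:
  assumes pq: "(p, q) \<in> simple_pairs n" and w: "w \<in> signed_perms {1..int n}"
  defines "a \<equiv> min \<bar>inv w p\<bar> \<bar>inv w q\<bar>" and "b \<equiv> max \<bar>inv w p\<bar> \<bar>inv w q\<bar>"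
  shows "invs {1..int n} (signed_transp p q \<circ> w) + rinv (w a) (w b) =
      invs {1..int n} w + rinv (signed_transp p q (w a)) (signed_transp p q (w b))"
    and "{\<bar>w a\<bar>, \<bar>w b\<bar>} = {\<bar>p\<bar>, \<bar>q\<bar>}"
proof -
  let ?S = "{1..int n}" and ?s = "signed_transp p q"
  note u = inv_signed_perms[OF w] and p = simple_pairs_abs[OF pq]
  have wu: "w (inv w i) = i" for i
    using signed_permsD(1)[OF w] by (simp add: bij_is_surj surj_f_inv_f)
  then have wu': "\<bar>w \<bar>inv w i\<bar>\<bar> = \<bar>i\<bar>" for i
    using signed_permsD(3)[OF w] by (simp add: abs_if)
  show ab: "{\<bar>w a\<bar>, \<bar>w b\<bar>} = {\<bar>p\<bar>, \<bar>q\<bar>}"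
    unfolding a_def b_def using wu'[of p] wu'[of q] by (auto simp: min_def max_def)
  have "\<bar>inv w p\<bar> \<in> ?S" "\<bar>inv w q\<bar> \<in> ?S"
    using signed_perms_abs_mem[OF u] p by blast+
  moreover have "\<bar>inv w p\<bar> \<noteq> \<bar>inv w q\<bar>"
    using signed_perms_abs_eq_iff[OF u] p by blast
  ultimately have mem: "(a, b) \<in> ord_pairs ?S"
    by (auto simp: ord_pairs_def a_def b_def min_def max_def)
  have rest: "rinv (?s (w i)) (?s (w j)) = rinv (w i) (w j)"
    if ij: "(i, j) \<in> ord_pairs ?S" "(i, j) \<noteq> (a, b)" for i j
  proof (rule rinv_signed_transp_eq[OF pq])
    have pos: "0 < i" "i < j" "0 < a" "a < b" "\<bar>i\<bar> \<in> ?S" "\<bar>j\<bar> \<in> ?S"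
      using ij(1) mem by (auto simp: ord_pairs_def)
    show "w i \<noteq> 0" "w j \<noteq> 0"
      using signed_perms_abs_mem[OF w] pos(5,6) by force+
    show "\<bar>w i\<bar> \<noteq> \<bar>w j\<bar>"
      using signed_perms_abs_eq_iff[OF w, of i j] pos by auto
    show "{\<bar>w i\<bar>, \<bar>w j\<bar>} \<noteq> {\<bar>p\<bar>, \<bar>q\<bar>}"
    proof
      assume "{\<bar>w i\<bar>, \<bar>w j\<bar>} = {\<bar>p\<bar>, \<bar>q\<bar>}"
      then have "{\<bar>w i\<bar>, \<bar>w j\<bar>} = {\<bar>w a\<bar>, \<bar>w b\<bar>}"
        using ab by simp
      then show False
        using pos ij(2) unfolding doubleton_eq_iff signed_perms_abs_eq_iff[OF w] by auto
    qed
  qed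
  have 1: "invs ?S (?s \<circ> w) = rinv (?s (w a)) (?s (w b)) +
      (\<Sum>(i, j) \<in> ord_pairs ?S - {(a, b)}. rinv (?s (w i)) (?s (w j)))"
    using mem by (simp add: invs_def sum.remove finite_ord_pairs)
  have 2: "(\<Sum>(i, j) \<in> ord_pairs ?S - {(a, b)}. rinv (?s (w i)) (?s (w j))) =
      (\<Sum>(i, j) \<in> ord_pairs ?S - {(a, b)}. rinv (w i) (w j))"
  proof (rule sum.cong[OF refl])
    fix z assume "z \<in> ord_pairs ?S - {(a, b)}"
    then show "(case z of (i, j) \<Rightarrow> rinv (?s (w i)) (?s (w j))) = (case z of (i, j) \<Rightarrow> rinv (w i) (w j))"
      using rest[of "fst z" "snd z"] by (auto simp: split_beta)
  qed
  have 3: "(\<Sum>(i, j) \<in> ord_pairs ?S - {(a, b)}. rinv (w i) (w j)) + rinv (w a) (w b) = invs ?S w"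
    using mem by (simp add: invs_def sum.remove[of _ "(a, b)"] finite_ord_pairs)
  show "invs ?S (?s \<circ> w) + rinv (w a) (w b) = invs ?S w + rinv (?s (w a)) (?s (w b))"
    using 1 2 3 by linarith
qed

lemma invs_left_mult_le:
  assumes "(p, q) \<in> simple_pairs n" "w \<in> signed_perms {1..int n}"
  shows "invs {1..int n} (signed_transp p q \<circ> w) \<le> invs {1..int n} w + 1"
  using invs_left_mult(1)[OF assms] rinv_signed_transp_le[OF assms(1) invs_left_mult(2)[OF assms]]
  by linarith

lemma invs_left_mult_less:
  assumes pq: "(p, q) \<in> simple_pairs n" and w: "w \<in> signed_perms {1..int n}"
    and desc: "inv w q < inv w p"
  shows "invs {1..int n} (signed_transp p q \<circ> w) < invs {1..int n} w"
proof -
  define a b where "a = min \<bar>inv w p\<bar> \<bar>inv w q\<bar>" and "b = max \<bar>inv w p\<bar> \<bar>inv w q\<bar>"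
  have wu: "w (inv w i) = i" "w (- inv w i) = - i" for i
    using signed_permsD(1,3)[OF w] by (simp_all add: bij_is_surj surj_f_inv_f)
  have wu': "\<bar>w \<bar>inv w i\<bar>\<bar> = \<bar>i\<bar>" for i
    using wu by (simp add: abs_if)
  \<comment> \<open>The descent says that \<open>inv w\<close> makes the simple root negative. It
    fixes the sign of whichever preimage has the larger absolute value: that of \<open>q\<close>
    must be negative, that of \<open>p\<close> positive.\<close>
  have "\<bar>w a\<bar> = \<bar>p\<bar> \<and> w b = - q \<or> \<bar>w a\<bar> = \<bar>q\<bar> \<and> w b = p"
  proof (cases "\<bar>inv w p\<bar> < \<bar>inv w q\<bar>")
    case True
    then have "a = \<bar>inv w p\<bar>" "b = - inv w q"
      using desc by (auto simp: a_def b_def)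
    then show ?thesis using wu wu' by simp
  next
    case False
    then have "a = \<bar>inv w q\<bar>" "b = inv w p"
      using desc by (auto simp: a_def b_def)
    then show ?thesis using wu wu' by simp
  qed
  then show ?thesis
    using rinv_signed_transp_less[OF pq, of "w a" "w b"]
      invs_left_mult(1)[OF pq w, folded a_def b_def]
    by linarith
qed

section \<open>The sign character of W(B_n) with kernel W(D_n)\<close>

definition sgn_prod :: "int set \<Rightarrow> (int \<Rightarrow> int) \<Rightarrow> int" where
  "sgn_prod S w = (\<Prod>i\<in>S. sgn (w i))"

text \<open>By oddness the sign of \<open>v (w i)\<close> is that of
  \<open>v \<bar>w i\<bar>\<close> times that of \<open>w i\<close>, and
  \<open>\<bar>w i\<bar>\<close> runs through \<open>S\<close>.\<close>

lemma sgn_prod_comp: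
  assumes "v \<in> signed_perms S" "w \<in> signed_perms S" "finite S" "S \<subseteq> {0<..}"
  shows "sgn_prod S (v \<circ> w) = sgn_prod S v * sgn_prod S w"
proof -
  have "v 0 = 0"
    using signed_permsD(3)[OF assms(1), of 0] by simp
  then have "sgn ((v \<circ> w) i) = sgn (v \<bar>w i\<bar>) * sgn (w i)" for i
    using signed_permsD(3)[OF assms(1), of "w i"]
    by (cases "w i" "0 :: int" rule: linorder_cases) (auto simp: sgn_minus)
  then have "sgn_prod S (v \<circ> w) = (\<Prod>i\<in>S. sgn (v \<bar>w i\<bar>)) * sgn_prod S w"
    by (simp add: sgn_prod_def prod.distrib)
  also have "(\<Prod>i\<in>S. sgn (v \<bar>w i\<bar>)) = sgn_prod S v"
    unfolding sgn_prod_def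
    by (rule prod.reindex_bij_betw[OF signed_perms_bij_betw_abs[OF assms(2-4)]])
  finally show ?thesis .
qed

lemma WD_iff: "w \<in> WD n \<longleftrightarrow> w \<in> signed_perms {1..int n} \<and> sgn_prod {1..int n} w = 1"
proof -
  have "sgn_prod {1..int n} w = (- 1) ^ card {i \<in> {1..int n}. w i < 0}"
    if w: "w \<in> signed_perms {1..int n}"
  proof -
    have "sgn (w i) = (if w i < 0 then - 1 else 1)" if "i \<in> {1..int n}" for i
      using signed_perms_abs_mem[OF w, of i] that by (auto simp: sgn_if)
    then have "sgn_prod {1..int n} w = (\<Prod>i \<in> {1..int n}. if w i < 0 then - 1 else 1)"
      unfolding sgn_prod_def by (intro prod.cong) auto
    then show ?thesis
      by (simp add: prod.If_cases Int_def)
  qed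
  then show ?thesis
    by (auto simp: WD_def WB_eq minus_one_power_iff split: if_splits)
qed

lemma sgn_prod_signed_transp:
  assumes "p \<noteq> 0" "q \<noteq> 0" "\<bar>p\<bar> \<noteq> \<bar>q\<bar>" "\<bar>p\<bar> \<in> S" "\<bar>q\<bar> \<in> S" "finite S" "S \<subseteq> {0<..}"
  shows "sgn_prod S (signed_transp p q) = 1"
proof -
  have "sgn_prod S (signed_transp p q) = (\<Prod>i\<in>{\<bar>p\<bar>, \<bar>q\<bar>}. sgn (signed_transp p q i))"
    unfolding sgn_prod_def
  proof (rule prod.mono_neutral_right)
    show "\<forall>i \<in> S - {\<bar>p\<bar>, \<bar>q\<bar>}. sgn (signed_transp p q i) = 1"
      using assms(7) by (auto simp: signed_transp_def)
  qed (use assms in auto)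
  also have "\<dots> = sgn (signed_transp p q \<bar>p\<bar>) * sgn (signed_transp p q \<bar>q\<bar>)"
    using assms(3) by simp
  also have "\<dots> = sgn (sgn p * q) * sgn (sgn q * p)"
    by (simp only: signed_transp_abs[OF assms(1-3)])
  also have "\<dots> = 1" 
    using assms(1,2) by (auto simp: sgn_mult sgn_if)
  finally show ?thesis .
qed

lemma sgn_prod_neg_cycle:
  assumes "i \<in> S" "finite S" "S \<subseteq> {0<..}"
  shows "sgn_prod S (neg_cycle i) = - 1"
proof -
  have "sgn_prod S (neg_cycle i) = (\<Prod>j\<in>{i}. sgn (neg_cycle i j))"
    unfolding sgn_prod_def
  proof (rule prod.mono_neutral_right)
    show "\<forall>j \<in> S - {i}. sgn (neg_cycle i j) = 1"
      using assms by (auto simp: neg_cycle_def)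
  qed (use assms in auto)
  then show ?thesis
    using assms by (auto simp: neg_cycle_def)
qed

lemma signed_transp_WD:
  assumes "p \<noteq> 0" "q \<noteq> 0" "\<bar>p\<bar> \<noteq> \<bar>q\<bar>" "\<bar>p\<bar> \<in> {1..int n}" "\<bar>q\<bar> \<in> {1..int n}"
  shows "signed_transp p q \<in> WD n"
  unfolding WD_iff
  using signed_involsD(1)[OF signed_transp_signed_invols[OF assms(1-3)]]
    signed_perms_mono[of "{\<bar>p\<bar>, \<bar>q\<bar>}" "{1..int n}"] assms
    sgn_prod_signed_transp[OF assms(1-5)]
  by auto

lemma id_WD: "id \<in> WD n"
  by (auto simp: WD_iff id_signed_perms sgn_prod_def intro!: prod.neutral)

lemma comp_WD: "v \<in> WD n \<Longrightarrow> w \<in> WD n \<Longrightarrow> v \<circ> w \<in> WD n"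
  using sgn_prod_comp[of v "{1..int n}" w] by (auto simp: WD_iff comp_signed_perms)

text \<open>Without descents the inverse \<open>u\<close> is increasing and \<open>u 2\<close>
  exceeds both \<open>u 1\<close> and \<open>- u 1\<close>, so all values from \<open>u 2\<close> on
  are positive and \<open>\<bar>u i\<bar>\<close> is at least \<open>i\<close>. This leaves the
  identity and the negative 1-cycle at 1, and parity excludes the latter.\<close>

lemma eq_id_if_no_descent:
  assumes w: "w \<in> WD n" and nd: "\<And>p q. (p, q) \<in> simple_pairs n \<Longrightarrow> inv w p < inv w q"
  shows "w = id"
proof -
  define u where "u = inv w"
  have w': "w \<in> signed_perms {1..int n}"
    using w by (simp add: WD_iff)
  have u: "u \<in> signed_perms {1..int n}"
    unfolding u_def by (rule inv_signed_perms[OF w'])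
  have wu: "w (u i) = i" for i
    using signed_permsD(1)[OF w'] by (simp add: u_def bij_is_surj surj_f_inv_f)
  have up: "u i < u (i + 1)" if "1 \<le> i" "i < int n" for i
    using nd[of i "i + 1"] that by (simp add: u_def simple_pairs_def)
  have up2: "- u 1 < u 2" if "2 \<le> n"
    using nd[of "- 1" 2] signed_permsD(3)[OF u, of 1] that by (simp add: u_def simple_pairs_def)
  have ge: "i \<le> int n \<longrightarrow> i \<le> \<bar>u i\<bar> \<and> (2 \<le> i \<longrightarrow> 0 < u i)" if "1 \<le> i" for i
    using that
  proof (induction i rule: int_ge_induct)
    case base
    then show ?case
      using signed_perms_abs_mem[OF u, of 1] by auto
  next
    case (step i)
    show ?case
    proof (cases "i = 1")
      case True
      then show ?thesis
        using up[of 1] up2 step by auto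
    next
      case False
      then show ?thesis
        using up[of i] step by auto
    qed
  qed
  \<comment> \<open>The absolute values permute \<open>{1..int n}\<close>, so the sums agree and the
    termwise inequalities are equalities.\<close>
  have "(\<Sum>i\<in>{1..int n}. i) = (\<Sum>i\<in>{1..int n}. \<bar>u i\<bar>)"
    using sum.reindex_bij_betw[OF signed_perms_bij_betw_abs[OF u], of id] by auto
  then have abs_u: "i = \<bar>u i\<bar>" if "i \<in> {1..int n}" for i
    using that ge by (intro sum_mono_inv[where f = "\<lambda>i. i" and g = "\<lambda>i. \<bar>u i\<bar>"]) auto
  then have w_id: "w i = i" if "i \<in> {2..int n}" for i
  proof -
    have "i = \<bar>u i\<bar>" "0 < u i"
      using that ge[of i] abs_u[of i] by simp_all
    then show ?thesis
      using wu[of i] by simp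
  qed
  have "w 1 = 1" if n: "1 \<le> n"
  proof (rule ccontr)
    assume "w 1 \<noteq> 1"
    then have "u 1 = - 1"
      using abs_u[of 1] wu[of 1] n by (auto simp: abs_if split: if_splits)
    then have "w 1 = - 1"
      using wu[of 1] signed_permsD(3)[OF w', of 1] by simp
    moreover have "i = 1 \<or> i \<in> {2..int n}" if "i \<in> {1..int n}" for i
      using that by auto
    ultimately have "{i \<in> {1..int n}. w i < 0} = {1}"
      using n w_id by fastforce
    then show False
      using w by (simp add: WD_def)
  qed
  then have "w i = id i" if "i \<in> {1..int n}" for i
    using w_id[of i] that by (cases "i = 1") auto
  then show "w = id"
    by (rule signed_perms_eqI[OF w' id_signed_perms])
qed

section \<open>Fundamental reflections as signed transpositions\<close>

lemma sum_evec_mult: "j \<in> {1..int n} \<Longrightarrow> (\<Sum>i = 1..int n. evec j i * f i) = f j"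
proof -
  assume j: "j \<in> {1..int n}"
  then have "(\<Sum>i = 1..int n. evec j i * f i) = (\<Sum>i = 1..int n. if i = j then f i else 0)"
    by (intro sum.cong) (auto simp: evec_def)
  then show ?thesis using j by simp
qed

lemma evec_inject: "x \<noteq> 0 \<Longrightarrow> evec x = evec y \<Longrightarrow> x = y"
  by (drule fun_cong[of _ _ "\<bar>x\<bar>"]) (auto simp: evec_def sgn_if abs_if split: if_splits)

lemma evec_sgn_mult: "evec (sgn c * z) k = of_int (sgn c) * evec z k"
  by (auto simp: evec_def sgn_if abs_if)

lemma act_evec: "j \<in> {1..int n} \<Longrightarrow> act n w (evec j) = evec (w j)"
  by (simp add: act_def sum_evec_mult)

lemma simple_roots_eq:
  "simple_roots n = (\<lambda>(p, q) k. evec q k - evec p k) ` simple_pairs n"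
proof -
  have "evec (- 1) k = - evec 1 k" for k
    by (simp add: evec_def)
  then show ?thesis
    by (auto simp: simple_roots_def simple_pairs_def image_iff fun_eq_iff)
qed

lemma act_signed_transp:
  assumes pq: "p \<noteq> 0" "q \<noteq> 0" "\<bar>p\<bar> \<noteq> \<bar>q\<bar>" "\<bar>p\<bar> \<in> {1..int n}" "\<bar>q\<bar> \<in> {1..int n}"
    and v: "v \<in> Rn n"
  shows "act n (signed_transp p q) v = refl_in n (\<lambda>k. evec q k - evec p k) v"
proof
  fix k
  define a where "a = (\<lambda>k. evec q k - evec p k)"
  have "ip n a a = (\<Sum>k\<in>{\<bar>p\<bar>, \<bar>q\<bar>}. a k * a k)"
    unfolding ip_def using pq by (intro sum.mono_neutral_right) (auto simp: a_def evec_def)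
  also have "\<dots> = 2"
    using pq by (auto simp: a_def evec_def sgn_if)
  finally have aa: "ip n a a = 2" .
  have vk: "v k = (\<Sum>i = 1..int n. v i * evec i k)"
  proof -
    have "(\<Sum>i = 1..int n. v i * evec i k) = (\<Sum>i = 1..int n. if i = k then v i else 0)"
      by (intro sum.cong) (auto simp: evec_def)
    then show ?thesis using v by (auto simp: Rn_def)
  qed
  \<comment> \<open>This is the reflection formula on a basis vector: \<open>a\<close> has squared
    norm 2 and \<open>a i\<close> is its inner product with \<open>evec i\<close>.\<close>
  have "evec (signed_transp p q i) k = evec i k - a i * a k" if i: "i \<in> {1..int n}" for i
  proof -
    have abs_evec: "evec \<bar>z\<bar> k = of_int (sgn z) * evec z k" for z
      using evec_sgn_mult[of z z k] by (simp add: abs_sgn mult.commute)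
    have a_abs: "a \<bar>p\<bar> = - of_int (sgn p)" "a \<bar>q\<bar> = of_int (sgn q)"
      using pq(3) by (auto simp: a_def evec_def)
    consider "i = \<bar>p\<bar>" | "i = \<bar>q\<bar>" | "i \<noteq> \<bar>p\<bar>" "i \<noteq> \<bar>q\<bar>"
      by blast
    then show ?thesis
    proof cases
      case 1
      show ?thesis
        unfolding 1 signed_transp_abs[OF pq(1-3)] a_abs evec_sgn_mult abs_evec
        by (simp add: a_def algebra_simps)
    next
      case 2
      show ?thesis
        unfolding 2 signed_transp_abs[OF pq(1-3)] a_abs evec_sgn_mult abs_evec
        by (simp add: a_def algebra_simps)
    next
      case 3
      then have "a i = 0" "signed_transp p q i = i"
        using i signed_transp_simps(5)[OF pq(1-3), of i] by (auto simp: a_def evec_def)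
      then show ?thesis by simp
    qed
  qed
  then have "act n (signed_transp p q) v k = (\<Sum>i = 1..int n. v i * (evec i k - a i * a k))"
    unfolding act_def by (intro sum.cong) auto
  also have "\<dots> = v k - ip n v a * a k"
    by (simp add: vk ip_def right_diff_distrib sum_subtractf sum_distrib_right mult.assoc)
  finally show "act n (signed_transp p q) v k = refl_in n (\<lambda>k. evec q k - evec p k) v k"
    by (simp add: refl_in_def aa flip: a_def)
qed

text \<open>A signed permutation is determined by its action on the basis vectors, so each simple
  root has exactly one reflection in the group.\<close>

lemma fund_refls_eq: "fund_refls n = (\<lambda>(p, q). signed_transp p q) ` simple_pairs n"
proof -
  have "s = signed_transp p q"
    if s: "s \<in> WD n" "\<forall>v \<in> Rn n. act n s v = refl_in n (\<lambda>k. evec q k - evec p k) v"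
      and pq: "(p, q) \<in> simple_pairs n" for s p q
  proof (rule signed_perms_eqI)
    note p = simple_pairs_abs[OF pq]
    show s': "s \<in> signed_perms {1..int n}" "signed_transp p q \<in> signed_perms {1..int n}"
      using s(1) signed_transp_WD[OF p] by (auto simp: WD_iff)
    fix j assume j: "j \<in> {1..int n}"
    then have "evec j \<in> Rn n"
      by (auto simp: Rn_def evec_def)
    then have "evec (s j) = evec (signed_transp p q j)"
      using s(2) act_signed_transp[OF p] act_evec[OF j] by metis
    moreover have "s j \<noteq> 0"
      using signed_perms_abs_mem[OF s'(1), of j] j by auto
    ultimately show "s j = signed_transp p q j"
      by (intro evec_inject)
  qed
  then show ?thesis
    unfolding fund_refls_def simple_roots_eq
    using signed_transp_WD[OF simple_pairs_abs] act_signed_transp[OF simple_pairs_abs]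
    by (auto simp: image_iff split: prod.splits) blast+
qed

section \<open>Length equals the number of inversions\<close>

lemma invs_id: "invs {1..int n} id = 0"
  unfolding invs_def by (rule sum.neutral) (auto simp: ord_pairs_def rinv_def)

lemma comp_list_Cons: "comp_list (c # cs) = c \<circ> comp_list cs"
  by simp

text \<open>Each factor adds at most one inversion, which bounds the length of any expression from
  below.\<close>

lemma comp_list_fund_refls:
  assumes "set ss \<subseteq> fund_refls n"
  shows "comp_list ss \<in> signed_perms {1..int n} \<and> invs {1..int n} (comp_list ss) \<le> length ss"
  using assms
proof (induction ss)
  case Nil
  show ?case
    using id_signed_perms invs_id[of n] by (auto simp: id_def)
next
  case (Cons s ss)
  then obtain p q where s: "s = signed_transp p q" "(p, q) \<in> simple_pairs n"
    by (auto simp: fund_refls_eq)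
  have IH: "comp_list ss \<in> signed_perms {1..int n}" "invs {1..int n} (comp_list ss) \<le> length ss"
    using Cons.IH Cons.prems by (metis insert_subset list.simps(15))+
  have "s \<in> signed_perms {1..int n}"
    using signed_transp_WD[OF simple_pairs_abs[OF s(2)]] s by (simp add: WD_iff)
  then have "s \<circ> comp_list ss \<in> signed_perms {1..int n}"
    using comp_signed_perms IH(1) by blast
  moreover have "invs {1..int n} (s \<circ> comp_list ss) \<le> length (s # ss)"
    using IH(2) invs_left_mult_le[OF s(2) IH(1)] s(1) by simp
  ultimately show ?case
    unfolding comp_list_Cons by blast
qed

lemma reduced_expression:
  assumes "w \<in> WD n"
  shows "\<exists>ss. length ss = invs {1..int n} w \<and> set ss \<subseteq> fund_refls n \<and> comp_list ss = w"
  using assms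
proof (induction "invs {1..int n} w" arbitrary: w rule: less_induct)
  case less
  have w: "w \<in> signed_perms {1..int n}"
    using less.prems by (simp add: WD_iff)
  show ?case
  proof (cases "w = id")
    case True
    then show ?thesis
      by (intro exI[of _ "[]"]) (simp add: invs_id)
  next
    case False
    then obtain p q where pq: "(p, q) \<in> simple_pairs n" "\<not> inv w p < inv w q"
      using eq_id_if_no_descent[OF less.prems] by blast
    note p = simple_pairs_abs[OF pq(1)]
    have "inv w p \<noteq> inv w q"
      using signed_permsD(2)[OF inv_signed_perms[OF w]] p(3) by (metis injD)
    then have desc: "inv w q < inv w p"
      using pq(2) by simp
    let ?s = "signed_transp p q"
    have sWD: "?s \<circ> w \<in> WD n"
      using comp_WD[OF signed_transp_WD[OF p] less.prems] .
    have ss: "?s \<circ> (?s \<circ> w) = w"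
      using signed_involsD(2)[OF signed_transp_signed_invols[OF p(1-3)]] by auto
    \<comment> \<open>Reflecting back from \<open>?s \<circ> w\<close> to \<open>w\<close> gains at
      most one inversion; together with the strict decrease the drop is exactly one.\<close>
    have "invs {1..int n} w \<le> invs {1..int n} (?s \<circ> w) + 1"
      using invs_left_mult_le[OF pq(1), of "?s \<circ> w"] sWD ss by (simp add: WD_iff)
    moreover have lt: "invs {1..int n} (?s \<circ> w) < invs {1..int n} w"
      using invs_left_mult_less[OF pq(1) w desc] .
    moreover obtain ts where "length ts = invs {1..int n} (?s \<circ> w)" "set ts \<subseteq> fund_refls n"
        "comp_list ts = ?s \<circ> w"
      using less.hyps[OF lt sWD] by blast
    ultimately show ?thesis
      using pq(1) ss by (intro exI[of _ "?s # ts"]) (auto simp: fund_refls_eq)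
  qed
qed

theorem lenD_eq_invs:
  assumes "w \<in> WD n"
  shows "lenD n w = invs {1..int n} w"
  unfolding lenD_def
proof (rule Least_equality)
  show "\<exists>ss. length ss = invs {1..int n} w \<and> set ss \<subseteq> fund_refls n \<and> comp_list ss = w"
    by (rule reduced_expression[OF assms])
  show "invs {1..int n} w \<le> k"
    if "\<exists>ss. length ss = k \<and> set ss \<subseteq> fund_refls n \<and> comp_list ss = w" for k
    using that comp_list_fund_refls by blast
qed

section \<open>Cycle expressions\<close>

lemma transps_cases:
  assumes "c \<in> transps n"
  obtains p q where "c = signed_transp p q" "p \<noteq> 0" "q \<noteq> 0" "\<bar>p\<bar> \<noteq> \<bar>q\<bar>"
    "\<bar>p\<bar> \<in> {1..int n}" "\<bar>q\<bar> \<in> {1..int n}"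
proof -
  from assms consider
    i j where "c = signed_transp i j" "i \<in> {1..int n}" "j \<in> {1..int n}" "i \<noteq> j"
    | i j where "c = signed_transp i (- j)" "i \<in> {1..int n}" "j \<in> {1..int n}" "i \<noteq> j"
    unfolding transps_def by blast
  then show ?thesis
    by cases (auto intro: that)
qed

lemma signed_transp_transps:
  assumes "0 < i" "\<bar>j\<bar> \<noteq> i" "j \<noteq> 0" "i \<le> int n" "\<bar>j\<bar> \<le> int n"
  shows "signed_transp i j \<in> transps n"
proof (cases "0 < j")
  case True
  then have "j \<in> {1..int n}" "i \<in> {1..int n}" "i \<noteq> j"
    using assms by auto
  then show ?thesis unfolding transps_def by blast
next
  case False
  then have "signed_transp i j = signed_transp i (- (- j))" "- j \<in> {1..int n}" "i \<noteq> - j" "i \<in> {1..int n}"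
    using assms by auto
  then show ?thesis unfolding transps_def by blast
qed

lemma transps_props:
  assumes "c \<in> transps n"
  shows "c \<in> signed_invols {1..int n}" "negs c = 0" "movs c = 2" "sgn_prod {1..int n} c = 1"
proof -
  obtain p q where c: "c = signed_transp p q" and p: "p \<noteq> 0" "q \<noteq> 0" "\<bar>p\<bar> \<noteq> \<bar>q\<bar>"
    "\<bar>p\<bar> \<in> {1..int n}" "\<bar>q\<bar> \<in> {1..int n}"
    using transps_cases[OF assms] by blast
  have "signed_invols {\<bar>p\<bar>, \<bar>q\<bar>} \<subseteq> signed_invols {1..int n}"
    using p by (intro signed_invols_mono) auto
  then show "c \<in> signed_invols {1..int n}"
    using signed_transp_signed_invols[OF p(1-3)] c by blast
  show "negs c = 0" "movs c = 2" "sgn_prod {1..int n} c = 1"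
    using negs_movs_signed_transp[OF p(1-3)] sgn_prod_signed_transp[OF p] c by simp_all
qed

lemma neg_cycles_props:
  assumes "c \<in> neg_cycles n"
  shows "c \<in> signed_invols {1..int n}" "negs c = 1" "movs c = 0" "sgn_prod {1..int n} c = - 1"
proof -
  obtain i where c: "c = neg_cycle i" and i: "i \<in> {1..int n}"
    using assms by (auto simp: neg_cycles_def)
  then have "signed_invols {i} \<subseteq> signed_invols {1..int n}" "0 < i"
    by (auto intro!: signed_invols_mono)
  then show "c \<in> signed_invols {1..int n}" "negs c = 1" "movs c = 0" "sgn_prod {1..int n} c = - 1"
    using neg_cycle_signed_invols[of i] negs_movs_neg_cycle[of i] sgn_prod_neg_cycle[OF i] c by auto
qed

text \<open>The support is tracked along with the counts because additivity at each step requires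
  the next cycle to be disjoint from the whole remaining product.\<close>

lemma comp_list_disjoint:
  assumes "set cs \<subseteq> transps n \<union> neg_cycles n" "sorted_wrt (\<lambda>c d. supp c \<inter> supp d = {}) cs"
  shows "comp_list cs \<in> signed_perms {1..int n} \<and> supp (comp_list cs) = (\<Union>c \<in> set cs. supp c) \<and>
    negs (comp_list cs) = sum_list (map negs cs) \<and> movs (comp_list cs) = sum_list (map movs cs) \<and>
    sgn_prod {1..int n} (comp_list cs) = prod_list (map (sgn_prod {1..int n}) cs)"
  using assms
proof (induction cs)
  case Nil
  have "comp_list [] = (id :: int \<Rightarrow> int)" "supp id = {}"
    by (auto simp: supp_def)
  then show ?case
    using id_WD[of n] by (simp only: negs_movs_id WD_iff) simp
next
  case (Cons c cs)
  then have c: "c \<in> signed_perms {1..int n}"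
    using transps_props(1) neg_cycles_props(1) signed_involsD(1) by auto
  have "set cs \<subseteq> transps n \<union> neg_cycles n" "sorted_wrt (\<lambda>c d. supp c \<inter> supp d = {}) cs"
    using Cons.prems by simp_all
  note IH' = Cons.IH[OF this]
  have IH: "comp_list cs \<in> signed_perms {1..int n}" "supp (comp_list cs) = (\<Union>c \<in> set cs. supp c)"
    "negs (comp_list cs) = sum_list (map negs cs)" "movs (comp_list cs) = sum_list (map movs cs)"
    "sgn_prod {1..int n} (comp_list cs) = prod_list (map (sgn_prod {1..int n}) cs)"
    using IH' by blast+
  note inj = signed_permsD(2)[OF IH(1)]
  have disj: "supp c \<inter> supp (comp_list cs) = {}"
    using Cons.prems(2) IH(2) by auto
  have fin: "finite (supp c)" "finite (supp (comp_list cs))"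
    using finite_supp c IH(1) by blast+
  have "c \<circ> comp_list cs \<in> signed_perms {1..int n}"
    using comp_signed_perms[OF c IH(1)] .
  moreover have "supp (c \<circ> comp_list cs) = (\<Union>c \<in> set (c # cs). supp c)"
    using supp_comp[OF inj disj] IH(2) by simp
  moreover have "negs (c \<circ> comp_list cs) = sum_list (map negs (c # cs))"
    "movs (c \<circ> comp_list cs) = sum_list (map movs (c # cs))"
    using negs_comp[OF inj disj fin] movs_comp[OF inj disj fin] IH(3,4) by simp_all
  moreover have "sgn_prod {1..int n} (c \<circ> comp_list cs) =
      prod_list (map (sgn_prod {1..int n}) (c # cs))"
    using sgn_prod_comp[OF c IH(1)] IH(5) by simp
  ultimately show ?case
    unfolding comp_list_Cons by blast
qed

lemma map_eq_replicate: "length xs = k \<Longrightarrow> (\<And>x. x \<in> set xs \<Longrightarrow> f x = a) \<Longrightarrow> map f xs = replicate k a"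
  by (metis map_cong map_replicate_const)

text \<open>Hence \<open>m\<close> and \<open>e\<close> do not depend on the chosen expression, and
  the parity of \<open>e\<close> decides membership in W(D_n).\<close>

lemma has_cycle_expr_imp:
  assumes "has_cycle_expr n m e x"
  shows "negs x = e" "movs x = 2 * m" "sgn_prod {1..int n} x = (- 1) ^ e"
proof -
  obtain ts ns where l: "length ts = m" "set ts \<subseteq> transps n" "length ns = e" "set ns \<subseteq> neg_cycles n"
      "sorted_wrt (\<lambda>c d. supp c \<inter> supp d = {}) (ts @ ns)" and x: "x = comp_list (ts @ ns)"
    using assms unfolding has_cycle_expr_def by blast
  have ts: "map negs ts = replicate m 0" "map movs ts = replicate m 2"
      "map (sgn_prod {1..int n}) ts = replicate m 1"
    using l(1,2) transps_props(2-4) by (auto intro!: map_eq_replicate)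
  have ns: "map negs ns = replicate e 1" "map movs ns = replicate e 0"
      "map (sgn_prod {1..int n}) ns = replicate e (- 1)"
    using l(3,4) neg_cycles_props(2-4) by (auto intro!: map_eq_replicate)
  have "set (ts @ ns) \<subseteq> transps n \<union> neg_cycles n"
    using l by auto
  from comp_list_disjoint[OF this l(5), folded x]
  show "negs x = e" "movs x = 2 * m" "sgn_prod {1..int n} x = (- 1) ^ e"
    by (simp_all add: ts ns sum_list_replicate)
qed


section \<open>Existence of cycle expressions\<close>

text \<open>Splits off one cycle: the remaining factor is \<open>c \<circ> x\<close>, which fixes
  \<open>T\<close> pointwise.\<close>

lemma disjoint_expr_cons:
  assumes c: "c \<in> signed_invols T" and T: "T \<subseteq> {1..int n}" and x: "x \<in> signed_invols {1..int n}"
    and agree: "\<And>i. i \<in> T \<Longrightarrow> x i = c i"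
  obtains y where "y \<in> signed_invols {1..int n}" "x = c \<circ> y" "supp c \<inter> supp y = {}"
    "negs x = negs c + negs y" "movs x = movs c + movs y"
proof -
  let ?S = "{1..int n}"
  have pos: "T \<subseteq> {0<..}"
    using T by auto
  have y: "c \<circ> x \<in> signed_invols (?S - T)"
    by (rule signed_invols_unglue[OF c T pos x agree])
  have eq: "x = c \<circ> (c \<circ> x)"
    using signed_involsD(2)[OF c] by auto
  show ?thesis
  proof (rule that)
    show "c \<circ> x \<in> signed_invols ?S"
      using y signed_invols_mono[of "?S - T" ?S] by blast
    show "supp c \<inter> supp (c \<circ> x) = {}"
      using supp_signed_perms[OF signed_involsD(1)[OF c]] supp_signed_perms[OF signed_involsD(1)[OF y]]
      by auto
    show "negs x = negs c + negs (c \<circ> x)" "movs x = movs c + movs (c \<circ> x)"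
      using negs_glue[OF c y T] movs_glue[OF c y T] eq by simp_all
  qed (rule eq)
qed

lemma comp_list_Cons_disjoint:
  assumes "set cs \<subseteq> transps n \<union> neg_cycles n" "sorted_wrt (\<lambda>c d. supp c \<inter> supp d = {}) cs"
    "supp c \<inter> supp (comp_list cs) = {}"
  shows "sorted_wrt (\<lambda>c d. supp c \<inter> supp d = {}) (c # cs)"
  using comp_list_disjoint[OF assms(1,2)] assms(2,3) by auto

lemma neg_cycles_expr:
  assumes "x \<in> signed_invols {1..int n}" "negs x = e" "movs x = 0"
  shows "\<exists>ns. length ns = e \<and> set ns \<subseteq> neg_cycles n \<and>
    sorted_wrt (\<lambda>c d. supp c \<inter> supp d = {}) ns \<and> x = comp_list ns"
  using assms
proof (induction e arbitrary: x)
  case 0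
  have x: "x \<in> signed_perms {1..int n}"
    by (rule signed_involsD(1)[OF 0(1)])
  \<comment> \<open>An infinite set would also have cardinality 0, so emptiness requires finiteness,
    here inherited from the support of \<open>x\<close>.\<close>
  have fin: "finite {i. 0 < i \<and> P i (x i)}" if "\<And>i. 0 < i \<Longrightarrow> P i (x i) \<Longrightarrow> x i \<noteq> i" for P
    by (rule finite_subset[OF _ finite_supp[OF _ x]]) (use that in \<open>auto simp: supp_def\<close>)
  have neg: "{i. 0 < i \<and> x i = - i} = {}"
    using 0(2) fin[of "\<lambda>i j. j = - i"] by (auto simp: negs_def)
  have mov: "{i. 0 < i \<and> \<bar>x i\<bar> \<noteq> i} = {}"
    using 0(3) fin[of "\<lambda>i j. \<bar>j\<bar> \<noteq> i"] by (auto simp: movs_def)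
  have "x i = i" if "i \<in> {1..int n}" for i
  proof -
    have "x i \<noteq> - i" "\<bar>x i\<bar> = i"
      using that neg mov by auto
    then show ?thesis by linarith
  qed
  then have "x = id"
    by (intro signed_perms_eqI[OF x id_signed_perms]) simp
  then show ?case
    by (intro exI[of _ "[]"]) simp
next
  case (Suc e)
  have "{i. 0 < i \<and> x i = - i} \<noteq> {}"
    using Suc.prems(2) by (metis card.empty negs_def nat.distinct(1))
  then obtain i where i: "0 < i" "x i = - i"
    by blast
  have "i \<in> {1..int n}"
    using signed_involsD(4)[OF Suc.prems(1), of i] i by auto
  then have c: "neg_cycle i \<in> neg_cycles n"
    by (auto simp: neg_cycles_def)
  obtain y where y: "y \<in> signed_invols {1..int n}" "x = neg_cycle i \<circ> y"
      "supp (neg_cycle i) \<inter> supp y = {}" "negs x = negs (neg_cycle i) + negs y"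
      "movs x = movs (neg_cycle i) + movs y"
  proof (rule disjoint_expr_cons[OF neg_cycle_signed_invols[OF i(1)] _ Suc.prems(1)])
    show "{i} \<subseteq> {1..int n}"
      using \<open>i \<in> {1..int n}\<close> by simp
    show "x j = neg_cycle i j" if "j \<in> {i}" for j
      using that i by (simp add: neg_cycle_def)
  qed
  have "negs y = e" "movs y = 0"
    using y(4,5) Suc.prems(2,3) negs_movs_neg_cycle[OF i(1)] by auto
  then obtain ns where ns: "length ns = e" "set ns \<subseteq> neg_cycles n"
      "sorted_wrt (\<lambda>c d. supp c \<inter> supp d = {}) ns" "y = comp_list ns"
    using Suc.IH[OF y(1)] by blast
  have "sorted_wrt (\<lambda>c d. supp c \<inter> supp d = {}) (neg_cycle i # ns)"
    by (rule comp_list_Cons_disjoint[of _ n]) (use ns y(3) in auto)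
  moreover have "x = comp_list (neg_cycle i # ns)"
    using y(2) ns(4) by simp
  moreover have "set (neg_cycle i # ns) \<subseteq> neg_cycles n" "length (neg_cycle i # ns) = Suc e"
    using ns c by auto
  ultimately show ?case by blast
qed

text \<open>Transpositions are split off first and placed at the front of the list; once none is
  left, \<open>neg_cycles_expr\<close> supplies the rest.\<close>

lemma has_cycle_exprI:
  assumes "x \<in> signed_invols {1..int n}" "negs x = e" "movs x = 2 * m"
  shows "has_cycle_expr n m e x"
  using assms
proof (induction m arbitrary: x)
  case 0
  then obtain ns where "length ns = e" "set ns \<subseteq> neg_cycles n"
      "sorted_wrt (\<lambda>c d. supp c \<inter> supp d = {}) ns" "x = comp_list ns"
    using neg_cycles_expr[of x n e] by auto
  then show ?case
    unfolding has_cycle_expr_def by (intro exI[of _ "[]"] exI[of _ ns]) simp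
next
  case (Suc m)
  note x = signed_involsD[OF Suc.prems(1)]
  have "{i. 0 < i \<and> \<bar>x i\<bar> \<noteq> i} \<noteq> {}"
    using Suc.prems(3) by (auto simp: movs_def simp del: Collect_empty_eq)
  then obtain i where i: "0 < i" "\<bar>x i\<bar> \<noteq> i"
    by blast
  have mem: "i \<in> {1..int n}" "\<bar>x i\<bar> \<in> {1..int n}"
    using x(4,5)[of i] i by force+
  \<comment> \<open>The sign of \<open>x i\<close> selects between the two kinds of
    transposition.\<close>
  let ?c = "signed_transp i (x i)"
  have nz: "i \<noteq> 0" "x i \<noteq> 0" "\<bar>i\<bar> \<noteq> \<bar>x i\<bar>"
    using i mem by auto
  have c: "?c \<in> transps n"
    using signed_transp_transps[of i "x i" n] i mem by auto
  obtain y where y: "y \<in> signed_invols {1..int n}" "x = ?c \<circ> y"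
      "supp ?c \<inter> supp y = {}" "negs x = negs ?c + negs y" "movs x = movs ?c + movs y"
  proof (rule disjoint_expr_cons[OF signed_transp_signed_invols[OF nz] _ Suc.prems(1)])
    show "{\<bar>i\<bar>, \<bar>x i\<bar>} \<subseteq> {1..int n}"
      using mem by auto
    show "x j = ?c j" if "j \<in> {\<bar>i\<bar>, \<bar>x i\<bar>}" for j
      using that i x(2,3)[of i] x(3)[of "x i"] signed_transp_simps(1-4)[OF nz]
      by (auto simp: abs_if split: if_splits)
  qed
  have "negs y = e" "movs y = 2 * m"
    using y(4,5) Suc.prems(2,3) negs_movs_signed_transp[OF nz] by auto
  then obtain ts ns where tn: "length ts = m" "set ts \<subseteq> transps n" "length ns = e"
      "set ns \<subseteq> neg_cycles n" "sorted_wrt (\<lambda>c d. supp c \<inter> supp d = {}) (ts @ ns)"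
      "y = comp_list (ts @ ns)"
    using Suc.IH[OF y(1)] unfolding has_cycle_expr_def by blast
  have "sorted_wrt (\<lambda>c d. supp c \<inter> supp d = {}) (?c # (ts @ ns))"
    by (rule comp_list_Cons_disjoint[of _ n, OF _ tn(5)])
      (use tn(2,4) y(3) in \<open>auto simp only: tn(6) set_append\<close>)
  moreover have "x = comp_list (?c # (ts @ ns))"
    using y(2) tn(6) by simp
  ultimately show ?case
    unfolding has_cycle_expr_def using tn(1-4) c
    by (intro exI[of _ "?c # ts"] exI[of _ ns]) simp
qed

lemma delta_eq:
  "delta n m e l = (if even e
     then card {x \<in> invol_class {1..int n} (int m) (int e). invs {1..int n} x = l} else 0)"
proof -
  have "x \<in> WD n \<and> x \<circ> x = id \<and> lenD n x = l \<and> has_cycle_expr n m e x \<longleftrightarrow>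
      even e \<and> x \<in> invol_class {1..int n} (int m) (int e) \<and> invs {1..int n} x = l" (is "?L \<longleftrightarrow> ?R") for x
  proof
    assume ?L
    then show ?R
      using has_cycle_expr_imp[of n m e x] lenD_eq_invs[of x n]
      by (auto simp: WD_iff invol_class_def signed_invols_def minus_one_power_iff split: if_splits)
  next
    assume R: ?R
    then have x: "x \<in> signed_invols {1..int n}" "has_cycle_expr n m e x"
      by (auto simp: invol_class_def intro!: has_cycle_exprI)
    then have "x \<in> WD n"
      using R has_cycle_expr_imp(3) by (auto simp: WD_iff signed_invols_def)
    then show ?L
      using R x lenD_eq_invs by (auto simp: signed_invols_def)
  qed
  then show ?thesis
    unfolding delta_def by auto
qed

lemma coeff_inv_poly:
  assumes "finite S"
  shows "coeff (inv_poly S m e) l = int (card {x \<in> invol_class S m e. invs S x = l})"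
proof -
  have "tX ^ k = monom 1 k" for k
    by (simp add: monom_altdef)
  then have "coeff (inv_poly S m e) l = (\<Sum>x \<in> invol_class S m e. if invs S x = l then 1 else 0)"
    by (simp add: inv_poly_def coeff_sum coeff_monom)
  then show ?thesis
    using finite_invol_class[OF assms] by (simp add: sum.If_cases Int_def)
qed

theorem theorem1p3:
  fixes n m e :: nat
  assumes "n \<ge> 1"
  shows "(\<forall>l. int (delta n m e l) =
            (if even e then coeff (Dpoly n (int m) (int e)) l else 0)) \<and>
         L n m e = (if even e then fps_of_poly (Dpoly n (int m) (int e)) else 0)"
proof -
  have "int (delta n m e l) = (if even e then coeff (Dpoly n (int m) (int e)) l else 0)" for l
    using inv_poly_eq_Dpoly[of "{1..int n}" "int m" "int e"]
      coeff_inv_poly[of "{1..int n}" "int m" "int e" l]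
    by (simp add: delta_eq)
  then show ?thesis
    by (auto simp: L_def fps_eq_iff)
qed

end
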